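(* Let $A$ (written multiplicatively) and $B$ (written additively) be abelian groups, and let $\mathcal{C}$ be a group-like monoidal groupoid with $\pi_0(\mathcal{C})=B$ and $\mathrm{Aut}_{\mathcal{C}}(I)=A$, for which the $B$-module structure on $A$ is trivial, described by a 3-cocycle $f(x,y,z)$. Then the commutator weak biextension $E$ of $B\times B$ by $A$ associated to $\mathcal{C}$ is a genuine biextension of $B\times B$ by $A$ if and only if the alternating map $$\varphi_{\mathcal{C}}:\Lambda^3B\to A$$ defined by $$\varphi_{\mathcal{C}}(x,y,z)=\frac{f(x,y,z)\,f(z,x,y)\,f(y,z,x)}{f(x,z,y)\,f(z,y,x)\,f(y,x,z)}$$ is trivial.
   Context: A group-like monoidal groupoid is a monoidal category $\mathcal{C}$ (tensor product written $XY$, unit $I$, associativity isomorphisms $a_{X,Y,Z}:X(YZ)\to(XY)Z$) in which all arrows are invertible and each object is invertible up to isomorphism. $\pi_0(\mathcal{C})$ is the group of isomorphism classes of objects. Each $\mathrm{Aut}(X)$ is identified with $A=\mathrm{Aut}(I)$ by $a\mapsto a\otimes X$; then $a\mapsto X\otimes a$ defines the action of the class $x\in B$ of $X$ on $A$, assumed trivial. Cocycle: choose objects $X_x$ of class $x$ for each $x\in B$ and arrows $c_{x,y}:X_xX_y\to X_{x+y}$. The normalized 3-cocycle $f:B^3\to A$ describing $\mathcal{C}$ is defined by $c_{x+y,z}\circ(c_{x,y}X_z)\circ a_{x,y,z}=f(x,y,z)\circ c_{x,y+z}\circ(X_xc_{y,z})$ in $\mathcal{C}$, with $f(x,y,z)\in\mathrm{Aut}(X_{x+y+z})=A$.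 Commutator: $E$ is the $A$-torsor on $B\times B$ with fibres $E_{x,y}=\mathrm{Isom}_{\mathcal{C}}(X_yX_x,X_xX_y)$. Partial laws: for $u\in E_{x,y}$, $v\in E_{x',y}$, $u\stackrel{1}{+}v\in E_{x+x',y}$ is the composite $$X_yX_{x+x'}\to X_y(X_xX_{x'})\to(X_yX_x)X_{x'}\xrightarrow{u}(X_xX_y)X_{x'}\to X_x(X_yX_{x'})\xrightarrow{v}X_x(X_{x'}X_y)\to(X_xX_{x'})X_y\to X_{x+x'}X_y;$$ for $u\in E_{x,y}$, $w\in E_{x,y'}$, $u\stackrel{2}{+}w\in E_{x,y+y'}$ is the composite $$X_{y+y'}X_x\to(X_yX_{y'})X_x\to X_y(X_{y'}X_x)\xrightarrow{w}X_y(X_xX_{y'})\to(X_yX_x)X_{y'}\xrightarrow{u}(X_xX_y)X_{y'}\to X_x(X_yX_{y'})\to X_xX_{y+y'}$$ (unlabelled arrows: associativity isomorphisms, and arrows induced by $c^{\pm1}$ at the ends). A weak biextension is an $A$-torsor on $B\times B$ with two such partial laws (morphisms of $A$-torsors) which are associative and compatible: $(a\stackrel{1}{+}b)\stackrel{2}{+}(c\stackrel{1}{+}d)=(a\stackrel{2}{+}c)\stackrel{1}{+}(b\stackrel{2}{+}d)$ for $a\in E_{x,y}$, $b\in E_{x',y}$, $c\in E_{x,y'}$, $d\in E_{x',y'}$; it is a genuine biextension if in addition both partial laws are commutative. The commutator torsor $E$, with its partial laws $\stackrel{1}{+}$ and $\stackrel{2}{+}$, is a weak biextension. *)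

theory Defs
  imports "HOL-Algebra.Free_Abelian_Groups"
begin

section \<open>Group-like monoidal groupoids\<close>

text \<open>A monoidal category with set of objects \<open>Obj\<close> and set of arrows \<open>Arr\<close>. The arrow
  \<open>Assoc X Y Z\<close> goes from \<open>X(YZ)\<close> to \<open>(XY)Z\<close>. All operations are only meaningful
  on objects and on (composable) arrows.\<close>

record ('o, 'm) moncat =
  Obj :: "'o set"
  Arr :: "'m set"
  Src :: "'m \<Rightarrow> 'o"
  Tgt :: "'m \<Rightarrow> 'o"
  Ident :: "'o \<Rightarrow> 'm"
  Comp :: "'m \<Rightarrow> 'm \<Rightarrow> 'm" (infixr \<open>\<cdot>\<index>\<close> 55)
  TenO :: "'o \<Rightarrow> 'o \<Rightarrow> 'o" (infixl \<open>\<boxdot>\<index>\<close> 65)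
  TenA :: "'m \<Rightarrow> 'm \<Rightarrow> 'm" (infixl \<open>\<boxtimes>\<index>\<close> 65)
  Unit :: "'o"
  Assoc :: "'o \<Rightarrow> 'o \<Rightarrow> 'o \<Rightarrow> 'm"
  Lunit :: "'o \<Rightarrow> 'm"
  Runit :: "'o \<Rightarrow> 'm"

definition homs :: "('o, 'm) moncat \<Rightarrow> 'o \<Rightarrow> 'o \<Rightarrow> 'm set" where
  "homs C X Y = {u \<in> Arr C. Src C u = X \<and> Tgt C u = Y}"

definition inverse_arrows :: "('o, 'm) moncat \<Rightarrow> 'm \<Rightarrow> 'm \<Rightarrow> bool" where
  "inverse_arrows C u v \<longleftrightarrow>
     u \<in> Arr C \<and> v \<in> Arr C \<and> Src C v = Tgt C u \<and> Tgt C v = Src C u \<and>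
     Comp C v u = Ident C (Src C u) \<and> Comp C u v = Ident C (Tgt C u)"

definition invertible_arrow :: "('o, 'm) moncat \<Rightarrow> 'm \<Rightarrow> bool" where
  "invertible_arrow C u \<longleftrightarrow> (\<exists>v. inverse_arrows C u v)"

definition inv_arrow :: "('o, 'm) moncat \<Rightarrow> 'm \<Rightarrow> 'm" where
  "inv_arrow C u = (THE v. inverse_arrows C u v)"

definition Isom :: "('o, 'm) moncat \<Rightarrow> 'o \<Rightarrow> 'o \<Rightarrow> 'm set" where
  "Isom C X Y = {u \<in> homs C X Y. invertible_arrow C u}"

definition isomorphic :: "('o, 'm) moncat \<Rightarrow> 'o \<Rightarrow> 'o \<Rightarrow> bool" where
  "isomorphic C X Y \<longleftrightarrow> Isom C X Y \<noteq> {}"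

locale monoidal_category =
  fixes C :: "('o, 'm) moncat" (structure)
  assumes Src_closed: "u \<in> Arr C \<Longrightarrow> Src C u \<in> Obj C"
    and Tgt_closed: "u \<in> Arr C \<Longrightarrow> Tgt C u \<in> Obj C"
    and Ident_closed: "X \<in> Obj C \<Longrightarrow> Ident C X \<in> homs C X X"
    and Comp_closed: "\<lbrakk>u \<in> homs C X Y; v \<in> homs C Y Z\<rbrakk> \<Longrightarrow> v \<cdot> u \<in> homs C X Z"
    and Comp_Ident: "u \<in> homs C X Y \<Longrightarrow> u \<cdot> Ident C X = u"
    and Ident_Comp: "u \<in> homs C X Y \<Longrightarrow> Ident C Y \<cdot> u = u"
    and Comp_assoc: "\<lbrakk>u \<in> homs C W X; v \<in> homs C X Y; w \<in> homs C Y Z\<rbrakk> \<Longrightarrow>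
          (w \<cdot> v) \<cdot> u = w \<cdot> (v \<cdot> u)"
    and TenO_closed: "\<lbrakk>X \<in> Obj C; Y \<in> Obj C\<rbrakk> \<Longrightarrow> X \<boxdot> Y \<in> Obj C"
    and TenA_closed: "\<lbrakk>u \<in> homs C X Y; u' \<in> homs C X' Y'\<rbrakk> \<Longrightarrow>
          u \<boxtimes> u' \<in> homs C (X \<boxdot> X') (Y \<boxdot> Y')"
    and TenA_Ident: "\<lbrakk>X \<in> Obj C; Y \<in> Obj C\<rbrakk> \<Longrightarrow>
          Ident C X \<boxtimes> Ident C Y = Ident C (X \<boxdot> Y)"
    and TenA_Comp: "\<lbrakk>u \<in> homs C X Y; v \<in> homs C Y Z; u' \<in> homs C X' Y'; v' \<in> homs C Y' Z'\<rbrakk> \<Longrightarrow>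
          (v \<cdot> u) \<boxtimes> (v' \<cdot> u') = (v \<boxtimes> v') \<cdot> (u \<boxtimes> u')"
    and Unit_closed: "Unit C \<in> Obj C"
    and Assoc_closed: "\<lbrakk>X \<in> Obj C; Y \<in> Obj C; Z \<in> Obj C\<rbrakk> \<Longrightarrow>
          Assoc C X Y Z \<in> Isom C (X \<boxdot> (Y \<boxdot> Z)) ((X \<boxdot> Y) \<boxdot> Z)"
    and Assoc_natural: "\<lbrakk>u \<in> homs C X X'; v \<in> homs C Y Y'; w \<in> homs C Z Z'\<rbrakk> \<Longrightarrow>
          Assoc C X' Y' Z' \<cdot> (u \<boxtimes> (v \<boxtimes> w)) = ((u \<boxtimes> v) \<boxtimes> w) \<cdot> Assoc C X Y Z"
    and Lunit_closed: "X \<in> Obj C \<Longrightarrow> Lunit C X \<in> Isom C (Unit C \<boxdot> X) X"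
    and Lunit_natural: "u \<in> homs C X Y \<Longrightarrow>
          Lunit C Y \<cdot> (Ident C (Unit C) \<boxtimes> u) = u \<cdot> Lunit C X"
    and Runit_closed: "X \<in> Obj C \<Longrightarrow> Runit C X \<in> Isom C (X \<boxdot> Unit C) X"
    and Runit_natural: "u \<in> homs C X Y \<Longrightarrow>
          Runit C Y \<cdot> (u \<boxtimes> Ident C (Unit C)) = u \<cdot> Runit C X"
    and pentagon: "\<lbrakk>W \<in> Obj C; X \<in> Obj C; Y \<in> Obj C; Z \<in> Obj C\<rbrakk> \<Longrightarrow>
          Assoc C (W \<boxdot> X) Y Z \<cdot> Assoc C W X (Y \<boxdot> Z) =
          (Assoc C W X Y \<boxtimes> Ident C Z) \<cdot> Assoc C W (X \<boxdot> Y) Z \<cdot> (Ident C W \<boxtimes> Assoc C X Y Z)"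
    and triangle: "\<lbrakk>X \<in> Obj C; Y \<in> Obj C\<rbrakk> \<Longrightarrow>
          (Runit C X \<boxtimes> Ident C Y) \<cdot> Assoc C X (Unit C) Y = Ident C X \<boxtimes> Lunit C Y"

locale grouplike_monoidal_groupoid = monoidal_category +
  assumes all_invertible: "u \<in> Arr C \<Longrightarrow> invertible_arrow C u"
    and object_invertible: "X \<in> Obj C \<Longrightarrow>
          \<exists>Y \<in> Obj C. isomorphic C (X \<boxdot> Y) (Unit C) \<and> isomorphic C (Y \<boxdot> X) (Unit C)"

definition iso_class :: "('o, 'm) moncat \<Rightarrow> 'o \<Rightarrow> 'o set" where
  "iso_class C X = {Y \<in> Obj C. isomorphic C X Y}"

definition pi0 :: "('o, 'm) moncat \<Rightarrow> 'o set monoid" where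
  "pi0 C = \<lparr>carrier = iso_class C ` Obj C,
            mult = (\<lambda>P Q. \<Union>X\<in>P. \<Union>Y\<in>Q. iso_class C (TenO C X Y)),
            one = iso_class C (Unit C)\<rparr>"

definition Aut :: "('o, 'm) moncat \<Rightarrow> 'o \<Rightarrow> 'm monoid" where
  "Aut C X = \<lparr>carrier = Isom C X X, mult = Comp C, one = Ident C X\<rparr>"

text \<open>The automorphisms \<open>a \<otimes> X\<close> and \<open>X \<otimes> a\<close> of \<open>X\<close>, for an automorphism \<open>a\<close> of the
  unit object \<open>I\<close>, where \<open>IX\<close> and \<open>XI\<close> are identified with \<open>X\<close> by the unit constraints.\<close>

definition aut_left :: "('o, 'm) moncat \<Rightarrow> 'o \<Rightarrow> 'm \<Rightarrow> 'm" where
  "aut_left C X a =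
     Comp C (Lunit C X) (Comp C (TenA C a (Ident C X)) (inv_arrow C (Lunit C X)))"

definition aut_right :: "('o, 'm) moncat \<Rightarrow> 'o \<Rightarrow> 'm \<Rightarrow> 'm" where
  "aut_right C X a =
     Comp C (Runit C X) (Comp C (TenA C (Ident C X) a) (inv_arrow C (Runit C X)))"

text \<open>The action on \<open>Aut(I)\<close> of the class of \<open>X\<close>: the automorphism \<open>X \<otimes> a\<close>, transported
  along the bijection \<open>a \<mapsto> a \<otimes> X\<close> from \<open>Aut(I)\<close> to \<open>Aut(X)\<close>.\<close>

definition pi0_action :: "('o, 'm) moncat \<Rightarrow> 'o \<Rightarrow> 'm \<Rightarrow> 'm" where
  "pi0_action C X a =
     inv_into (carrier (Aut C (Unit C))) (aut_left C X) (aut_right C X a)"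

definition trivial_pi0_action :: "('o, 'm) moncat \<Rightarrow> bool" where
  "trivial_pi0_action C \<longleftrightarrow>
     (\<forall>X \<in> Obj C. \<forall>a \<in> carrier (Aut C (Unit C)). pi0_action C X a = a)"

section \<open>The cocycle describing a group-like monoidal groupoid\<close>

text \<open>In the following, \<open>B\<close> is identified with \<open>pi0 C\<close> by an isomorphism \<open>\<beta>\<close>, and \<open>A\<close> with
  \<open>Aut C (Unit C)\<close> by an isomorphism \<open>\<alpha>\<close>. Both groups are written multiplicatively.\<close>

definition chosen_representatives ::
  "('o, 'm) moncat \<Rightarrow> 'b monoid \<Rightarrow> ('b \<Rightarrow> 'o set) \<Rightarrow> ('b \<Rightarrow> 'o) \<Rightarrow> ('b \<Rightarrow> 'b \<Rightarrow> 'm) \<Rightarrow> bool" where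
  "chosen_representatives C B \<beta> X c \<longleftrightarrow>
     (\<forall>x \<in> carrier B. X x \<in> \<beta> x) \<and>
     (\<forall>x \<in> carrier B. \<forall>y \<in> carrier B. c x y \<in> homs C (TenO C (X x) (X y)) (X (x \<otimes>\<^bsub>B\<^esub> y)))"

text \<open>\<open>f\<close> is normalized; the 3-cocycle identity for \<open>f\<close> is a consequence of the equation
  below.\<close>

definition describing_cocycle ::
  "('o, 'm) moncat \<Rightarrow> 'a monoid \<Rightarrow> 'b monoid \<Rightarrow> ('a \<Rightarrow> 'm) \<Rightarrow> ('b \<Rightarrow> 'o) \<Rightarrow> ('b \<Rightarrow> 'b \<Rightarrow> 'm)
     \<Rightarrow> ('b \<Rightarrow> 'b \<Rightarrow> 'b \<Rightarrow> 'a) \<Rightarrow> bool" where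
  "describing_cocycle C A B \<alpha> X c f \<longleftrightarrow>
     (\<forall>x \<in> carrier B. \<forall>y \<in> carrier B. \<forall>z \<in> carrier B.
        f x y z \<in> carrier A \<and>
        (x = \<one>\<^bsub>B\<^esub> \<or> y = \<one>\<^bsub>B\<^esub> \<or> z = \<one>\<^bsub>B\<^esub> \<longrightarrow> f x y z = \<one>\<^bsub>A\<^esub>) \<and>
        c (x \<otimes>\<^bsub>B\<^esub> y) z \<cdot>\<^bsub>C\<^esub> (c x y \<boxtimes>\<^bsub>C\<^esub> Ident C (X z)) \<cdot>\<^bsub>C\<^esub> Assoc C (X x) (X y) (X z) =
        aut_left C (X (x \<otimes>\<^bsub>B\<^esub> y \<otimes>\<^bsub>B\<^esub> z)) (\<alpha> (f x y z)) \<cdot>\<^bsub>C\<^esub>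
          c x (y \<otimes>\<^bsub>B\<^esub> z) \<cdot>\<^bsub>C\<^esub> (Ident C (X x) \<boxtimes>\<^bsub>C\<^esub> c y z))"

section \<open>Weak biextensions and biextensions\<close>

text \<open>A family of \<open>A\<close>-torsors \<open>E x y\<close> indexed by \<open>B \<times> B\<close>; \<open>act x y\<close> is the action of \<open>A\<close>
  on the fibre \<open>E x y\<close>.\<close>

definition torsor_on_square ::
  "'a monoid \<Rightarrow> 'b monoid \<Rightarrow> ('b \<Rightarrow> 'b \<Rightarrow> 'e set) \<Rightarrow> ('b \<Rightarrow> 'b \<Rightarrow> 'a \<Rightarrow> 'e \<Rightarrow> 'e) \<Rightarrow> bool" where
  "torsor_on_square A B E act \<longleftrightarrow>
     (\<forall>x \<in> carrier B. \<forall>y \<in> carrier B.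
        E x y \<noteq> {} \<and>
        (\<forall>a \<in> carrier A. \<forall>u \<in> E x y. act x y a u \<in> E x y) \<and>
        (\<forall>u \<in> E x y. act x y \<one>\<^bsub>A\<^esub> u = u) \<and>
        (\<forall>a \<in> carrier A. \<forall>b \<in> carrier A. \<forall>u \<in> E x y.
           act x y (a \<otimes>\<^bsub>A\<^esub> b) u = act x y a (act x y b u)) \<and>
        (\<forall>u \<in> E x y. \<forall>v \<in> E x y. \<exists>!a. a \<in> carrier A \<and> act x y a u = v))"

text \<open>The partial laws carry their base points as arguments: \<open>p1 x x' y\<close> maps
  \<open>E x y \<times> E x' y\<close> to \<open>E (x + x') y\<close>, and \<open>p2 x y y'\<close> maps \<open>E x y \<times> E x y'\<close> to
  \<open>E x (y + y')\<close>. Being morphisms of \<open>A\<close>-torsors (on the contracted product of the two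
  fibres), they are \<open>A\<close>-equivariant in both arguments.\<close>

definition weak_biextension ::
  "'a monoid \<Rightarrow> 'b monoid \<Rightarrow> ('b \<Rightarrow> 'b \<Rightarrow> 'e set) \<Rightarrow> ('b \<Rightarrow> 'b \<Rightarrow> 'a \<Rightarrow> 'e \<Rightarrow> 'e)
     \<Rightarrow> ('b \<Rightarrow> 'b \<Rightarrow> 'b \<Rightarrow> 'e \<Rightarrow> 'e \<Rightarrow> 'e) \<Rightarrow> ('b \<Rightarrow> 'b \<Rightarrow> 'b \<Rightarrow> 'e \<Rightarrow> 'e \<Rightarrow> 'e) \<Rightarrow> bool" where
  "weak_biextension A B E act p1 p2 \<longleftrightarrow>
     torsor_on_square A B E act \<and>
     (\<forall>x \<in> carrier B. \<forall>x' \<in> carrier B. \<forall>y \<in> carrier B. \<forall>u \<in> E x y. \<forall>v \<in> E x' y.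
        p1 x x' y u v \<in> E (x \<otimes>\<^bsub>B\<^esub> x') y \<and>
        (\<forall>a \<in> carrier A. \<forall>b \<in> carrier A.
           p1 x x' y (act x y a u) (act x' y b v) =
           act (x \<otimes>\<^bsub>B\<^esub> x') y (a \<otimes>\<^bsub>A\<^esub> b) (p1 x x' y u v))) \<and>
     (\<forall>x \<in> carrier B. \<forall>y \<in> carrier B. \<forall>y' \<in> carrier B. \<forall>u \<in> E x y. \<forall>w \<in> E x y'.
        p2 x y y' u w \<in> E x (y \<otimes>\<^bsub>B\<^esub> y') \<and>
        (\<forall>a \<in> carrier A. \<forall>b \<in> carrier A.
           p2 x y y' (act x y a u) (act x y' b w) =
           act x (y \<otimes>\<^bsub>B\<^esub> y') (a \<otimes>\<^bsub>A\<^esub> b) (p2 x y y' u w))) \<and>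
     (\<forall>x \<in> carrier B. \<forall>x' \<in> carrier B. \<forall>x'' \<in> carrier B. \<forall>y \<in> carrier B.
        \<forall>u \<in> E x y. \<forall>v \<in> E x' y. \<forall>w \<in> E x'' y.
          p1 (x \<otimes>\<^bsub>B\<^esub> x') x'' y (p1 x x' y u v) w =
          p1 x (x' \<otimes>\<^bsub>B\<^esub> x'') y u (p1 x' x'' y v w)) \<and>
     (\<forall>x \<in> carrier B. \<forall>y \<in> carrier B. \<forall>y' \<in> carrier B. \<forall>y'' \<in> carrier B.
        \<forall>u \<in> E x y. \<forall>v \<in> E x y'. \<forall>w \<in> E x y''.
          p2 x (y \<otimes>\<^bsub>B\<^esub> y') y'' (p2 x y y' u v) w =
          p2 x y (y' \<otimes>\<^bsub>B\<^esub> y'') u (p2 x y' y'' v w)) \<and>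
     (\<forall>x \<in> carrier B. \<forall>x' \<in> carrier B. \<forall>y \<in> carrier B. \<forall>y' \<in> carrier B.
        \<forall>a \<in> E x y. \<forall>b \<in> E x' y. \<forall>c \<in> E x y'. \<forall>d \<in> E x' y'.
          p2 (x \<otimes>\<^bsub>B\<^esub> x') y y' (p1 x x' y a b) (p1 x x' y' c d) =
          p1 x x' (y \<otimes>\<^bsub>B\<^esub> y') (p2 x y y' a c) (p2 x' y y' b d))"

definition biextension ::
  "'a monoid \<Rightarrow> 'b monoid \<Rightarrow> ('b \<Rightarrow> 'b \<Rightarrow> 'e set) \<Rightarrow> ('b \<Rightarrow> 'b \<Rightarrow> 'a \<Rightarrow> 'e \<Rightarrow> 'e)
     \<Rightarrow> ('b \<Rightarrow> 'b \<Rightarrow> 'b \<Rightarrow> 'e \<Rightarrow> 'e \<Rightarrow> 'e) \<Rightarrow> ('b \<Rightarrow> 'b \<Rightarrow> 'b \<Rightarrow> 'e \<Rightarrow> 'e \<Rightarrow> 'e) \<Rightarrow> bool" where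
  "biextension A B E act p1 p2 \<longleftrightarrow>
     weak_biextension A B E act p1 p2 \<and>
     (\<forall>x \<in> carrier B. \<forall>x' \<in> carrier B. \<forall>y \<in> carrier B. \<forall>u \<in> E x y. \<forall>v \<in> E x' y.
        p1 x x' y u v = p1 x' x y v u) \<and>
     (\<forall>x \<in> carrier B. \<forall>y \<in> carrier B. \<forall>y' \<in> carrier B. \<forall>u \<in> E x y. \<forall>w \<in> E x y'.
        p2 x y y' u w = p2 x y' y w u)"

section \<open>The commutator weak biextension\<close>

definition commutator_fibre :: "('o, 'm) moncat \<Rightarrow> ('b \<Rightarrow> 'o) \<Rightarrow> 'b \<Rightarrow> 'b \<Rightarrow> 'm set" where
  "commutator_fibre C X x y = Isom C (TenO C (X y) (X x)) (TenO C (X x) (X y))"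

definition commutator_action ::
  "('o, 'm) moncat \<Rightarrow> ('a \<Rightarrow> 'm) \<Rightarrow> ('b \<Rightarrow> 'o) \<Rightarrow> 'b \<Rightarrow> 'b \<Rightarrow> 'a \<Rightarrow> 'm \<Rightarrow> 'm" where
  "commutator_action C \<alpha> X x y a u = Comp C (aut_left C (TenO C (X x) (X y)) (\<alpha> a)) u"

definition commutator_law1 ::
  "('o, 'm) moncat \<Rightarrow> ('b \<Rightarrow> 'o) \<Rightarrow> ('b \<Rightarrow> 'b \<Rightarrow> 'm) \<Rightarrow> 'b \<Rightarrow> 'b \<Rightarrow> 'b \<Rightarrow> 'm \<Rightarrow> 'm \<Rightarrow> 'm" where
  "commutator_law1 C X c x x' y u v =
     (c x x' \<boxtimes>\<^bsub>C\<^esub> Ident C (X y)) \<cdot>\<^bsub>C\<^esub>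
     Assoc C (X x) (X x') (X y) \<cdot>\<^bsub>C\<^esub>
     (Ident C (X x) \<boxtimes>\<^bsub>C\<^esub> v) \<cdot>\<^bsub>C\<^esub>
     inv_arrow C (Assoc C (X x) (X y) (X x')) \<cdot>\<^bsub>C\<^esub>
     (u \<boxtimes>\<^bsub>C\<^esub> Ident C (X x')) \<cdot>\<^bsub>C\<^esub>
     Assoc C (X y) (X x) (X x') \<cdot>\<^bsub>C\<^esub>
     (Ident C (X y) \<boxtimes>\<^bsub>C\<^esub> inv_arrow C (c x x'))"

definition commutator_law2 ::
  "('o, 'm) moncat \<Rightarrow> ('b \<Rightarrow> 'o) \<Rightarrow> ('b \<Rightarrow> 'b \<Rightarrow> 'm) \<Rightarrow> 'b \<Rightarrow> 'b \<Rightarrow> 'b \<Rightarrow> 'm \<Rightarrow> 'm \<Rightarrow> 'm" where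
  "commutator_law2 C X c x y y' u w =
     (Ident C (X x) \<boxtimes>\<^bsub>C\<^esub> c y y') \<cdot>\<^bsub>C\<^esub>
     inv_arrow C (Assoc C (X x) (X y) (X y')) \<cdot>\<^bsub>C\<^esub>
     (u \<boxtimes>\<^bsub>C\<^esub> Ident C (X y')) \<cdot>\<^bsub>C\<^esub>
     Assoc C (X y) (X x) (X y') \<cdot>\<^bsub>C\<^esub>
     (Ident C (X y) \<boxtimes>\<^bsub>C\<^esub> w) \<cdot>\<^bsub>C\<^esub>
     inv_arrow C (Assoc C (X y) (X y') (X x)) \<cdot>\<^bsub>C\<^esub>
     (inv_arrow C (c y y') \<boxtimes>\<^bsub>C\<^esub> Ident C (X x))"

section \<open>The third exterior power of an abelian group\<close>

text \<open>The quotient of the free abelian group on \<open>B\<^sup>3\<close> (which is additive: its elements are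
  formal integer combinations) by the relations making \<open>wedge3\<close> trilinear and alternating.\<close>

definition triples :: "'b monoid \<Rightarrow> ('b \<times> 'b \<times> 'b) set" where
  "triples B = carrier B \<times> carrier B \<times> carrier B"

definition wedge3_relators :: "'b monoid \<Rightarrow> ('b \<times> 'b \<times> 'b \<Rightarrow>\<^sub>0 int) set" where
  "wedge3_relators B =
     {frag_of (x \<otimes>\<^bsub>B\<^esub> x', y, z) - frag_of (x, y, z) - frag_of (x', y, z) | x x' y z.
        x \<in> carrier B \<and> x' \<in> carrier B \<and> y \<in> carrier B \<and> z \<in> carrier B} \<union>
     {frag_of (x, y \<otimes>\<^bsub>B\<^esub> y', z) - frag_of (x, y, z) - frag_of (x, y', z) | x y y' z.
        x \<in> carrier B \<and> y \<in> carrier B \<and> y' \<in> carrier B \<and> z \<in> carrier B} \<union>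
     {frag_of (x, y, z \<otimes>\<^bsub>B\<^esub> z') - frag_of (x, y, z) - frag_of (x, y, z') | x y z z'.
        x \<in> carrier B \<and> y \<in> carrier B \<and> z \<in> carrier B \<and> z' \<in> carrier B} \<union>
     {frag_of (x, y, z) | x y z.
        x \<in> carrier B \<and> y \<in> carrier B \<and> z \<in> carrier B \<and> (x = y \<or> y = z \<or> x = z)}"

definition wedge3_relations :: "'b monoid \<Rightarrow> ('b \<times> 'b \<times> 'b \<Rightarrow>\<^sub>0 int) set" where
  "wedge3_relations B = generate (free_Abelian_group (triples B)) (wedge3_relators B)"

definition exterior_cube :: "'b monoid \<Rightarrow> ('b \<times> 'b \<times> 'b \<Rightarrow>\<^sub>0 int) set monoid" where
  "exterior_cube B = free_Abelian_group (triples B) Mod wedge3_relations B"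

definition wedge3 :: "'b monoid \<Rightarrow> 'b \<Rightarrow> 'b \<Rightarrow> 'b \<Rightarrow> ('b \<times> 'b \<times> 'b \<Rightarrow>\<^sub>0 int) set" where
  "wedge3 B x y z =
     wedge3_relations B #>\<^bsub>free_Abelian_group (triples B)\<^esub> frag_of (x, y, z)"

end

theory Submission
  imports Defs
begin

text \<open>The arrows \<open>c x y\<close> and \<open>c y x\<close> identify the fibre \<open>Isom (X\<^sub>yX\<^sub>x, X\<^sub>xX\<^sub>y)\<close> with \<open>A\<close>. As every
  associativity isomorphism then becomes a value of \<open>f\<close>, the partial laws become the product of
  \<open>A\<close> twisted by \<open>\<kappa>(x, x'; y) = f(y, x, x') f(x, x', y) / f(x, y, x')\<close>, respectively by
  \<open>1 / \<kappa>(y, y'; x)\<close>. The axioms of a weak biextension are identities between values of \<open>\<kappa>\<close>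
  that follow from the cocycle identity; in particular \<open>\<kappa>(-, -; y)\<close> is a 2-cocycle. Its
  commutator \<open>\<kappa>(x, x'; y) / \<kappa>(x', x; y)\<close> is therefore bimultiplicative in \<open>x, x'\<close>, and it equals
  \<open>\<phi>(x, x', y)\<close>. So \<open>\<phi>\<close> is both the obstruction to commutativity of the two laws and, being
  invariant under cyclic permutations, trilinear and alternating.\<close>

section \<open>Arrows of a group-like monoidal groupoid\<close>

text \<open>Coordinates work because every automorphism group is the same copy of A, compatibly with
  composition and with the tensor product. Three facts give this. Tensoring with an invertible
  object is fully faithful, so the map from Aut(I) to Aut(P) is bijective. The unit constraint of a
  product agrees with that of its left factor. Since B acts trivially, a scalar on either factor is
  the same scalar on the product. Coordinates are then multiplicative for both operations, and
  equations between long composites become equations in A. The identities for \<open>kappa\<close>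
  come from the bar complex of B: \<open>kappa\<close> and phi are \<open>f\<close> evaluated on the
  shuffle product of [x|y] with [z] and on that of [x], [y], [z]. For abelian B the shuffle product
  is compatible with boundaries, which tells in each proof which instances of the cocycle identity
  to combine, and with which signs.\<close>

context monoidal_category
begin

lemma Arr_closed [simp]:
  "u \<in> Arr C \<Longrightarrow> Src C u \<in> Obj C" "u \<in> Arr C \<Longrightarrow> Tgt C u \<in> Obj C"
  by (auto intro: Src_closed Tgt_closed)

lemma Ident_simps [simp]:
  assumes "P \<in> Obj C"
  shows "Ident C P \<in> Arr C" "Src C (Ident C P) = P" "Tgt C (Ident C P) = P"
  using Ident_closed[OF assms] by (auto simp: homs_def)

lemma Comp_simps [simp]:
  assumes "u \<in> Arr C" "v \<in> Arr C" "Src C v = Tgt C u"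
  shows "v \<cdot> u \<in> Arr C" "Src C (v \<cdot> u) = Src C u" "Tgt C (v \<cdot> u) = Tgt C v"
  using Comp_closed[of u "Src C u" "Tgt C u" v "Tgt C v"] assms by (auto simp: homs_def)

lemma TenO_simps [simp]: "\<lbrakk>P \<in> Obj C; Q \<in> Obj C\<rbrakk> \<Longrightarrow> P \<boxdot> Q \<in> Obj C"
  by (rule TenO_closed)

lemma TenA_simps [simp]:
  assumes "u \<in> Arr C" "v \<in> Arr C"
  shows "u \<boxtimes> v \<in> Arr C" "Src C (u \<boxtimes> v) = Src C u \<boxdot> Src C v" "Tgt C (u \<boxtimes> v) = Tgt C u \<boxdot> Tgt C v"
  using TenA_closed[of u "Src C u" "Tgt C u" v "Src C v" "Tgt C v"] assms by (auto simp: homs_def)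

lemma Unit_simps [simp]: "Unit C \<in> Obj C"
  by (rule Unit_closed)

lemma Assoc_simps [simp]:
  assumes "P \<in> Obj C" "Q \<in> Obj C" "R \<in> Obj C"
  shows "Assoc C P Q R \<in> Arr C" "Src C (Assoc C P Q R) = P \<boxdot> (Q \<boxdot> R)"
    "Tgt C (Assoc C P Q R) = (P \<boxdot> Q) \<boxdot> R"
  using Assoc_closed[OF assms] by (auto simp: homs_def Isom_def)

lemma Lunit_simps [simp]:
  assumes "P \<in> Obj C"
  shows "Lunit C P \<in> Arr C" "Src C (Lunit C P) = Unit C \<boxdot> P" "Tgt C (Lunit C P) = P"
  using Lunit_closed[OF assms] by (auto simp: homs_def Isom_def)

lemma Runit_simps [simp]:
  assumes "P \<in> Obj C"
  shows "Runit C P \<in> Arr C" "Src C (Runit C P) = P \<boxdot> Unit C" "Tgt C (Runit C P) = P"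
  using Runit_closed[OF assms] by (auto simp: homs_def Isom_def)

lemma Comp_Ident_simps [simp]:
  "\<lbrakk>u \<in> Arr C; P = Src C u\<rbrakk> \<Longrightarrow> u \<cdot> Ident C P = u"
  "\<lbrakk>u \<in> Arr C; P = Tgt C u\<rbrakk> \<Longrightarrow> Ident C P \<cdot> u = u"
  using Comp_Ident[of u "Src C u" "Tgt C u"] Ident_Comp[of u "Src C u" "Tgt C u"]
  by (auto simp: homs_def)

lemma Comp_assoc_Arr:
  "\<lbrakk>u \<in> Arr C; v \<in> Arr C; w \<in> Arr C; Src C v = Tgt C u; Src C w = Tgt C v\<rbrakk> \<Longrightarrow>
    (w \<cdot> v) \<cdot> u = w \<cdot> (v \<cdot> u)"
  using Comp_assoc[of u "Src C u" "Tgt C u" v "Tgt C v" w "Tgt C w"] by (auto simp: homs_def)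

lemma TenA_Comp_Arr:
  "\<lbrakk>u \<in> Arr C; v \<in> Arr C; u' \<in> Arr C; v' \<in> Arr C; Src C v = Tgt C u; Src C v' = Tgt C u'\<rbrakk> \<Longrightarrow>
    (v \<boxtimes> v') \<cdot> (u \<boxtimes> u') = (v \<cdot> u) \<boxtimes> (v' \<cdot> u')"
  using TenA_Comp[of u "Src C u" "Tgt C u" v "Tgt C v" u' "Src C u'" "Tgt C u'" v' "Tgt C v'"]
  by (auto simp: homs_def)

lemma Assoc_natural_Arr:
  "\<lbrakk>u \<in> Arr C; v \<in> Arr C; w \<in> Arr C\<rbrakk> \<Longrightarrow>
    ((u \<boxtimes> v) \<boxtimes> w) \<cdot> Assoc C (Src C u) (Src C v) (Src C w) =
    Assoc C (Tgt C u) (Tgt C v) (Tgt C w) \<cdot> (u \<boxtimes> (v \<boxtimes> w))"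
  using Assoc_natural[of u "Src C u" "Tgt C u" v "Src C v" "Tgt C v" w "Src C w" "Tgt C w"]
  by (auto simp: homs_def)

lemma Lunit_natural_Arr:
  "u \<in> Arr C \<Longrightarrow> Lunit C (Tgt C u) \<cdot> (Ident C (Unit C) \<boxtimes> u) = u \<cdot> Lunit C (Src C u)"
  using Lunit_natural[of u "Src C u" "Tgt C u"] by (auto simp: homs_def)

lemma Runit_natural_Arr:
  "u \<in> Arr C \<Longrightarrow> Runit C (Tgt C u) \<cdot> (u \<boxtimes> Ident C (Unit C)) = u \<cdot> Runit C (Src C u)"
  using Runit_natural[of u "Src C u" "Tgt C u"] by (auto simp: homs_def)

lemma inverse_arrows_unique:
  assumes "inverse_arrows C u v" "inverse_arrows C u w"
  shows "v = w"
proof -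
  have "v = (w \<cdot> u) \<cdot> v" using assms by (simp add: inverse_arrows_def)
  also have "\<dots> = w" using assms by (subst Comp_assoc_Arr) (auto simp: inverse_arrows_def)
  finally show ?thesis .
qed

end

section \<open>Inverses and cancellation of arrows in the groupoid\<close>

context grouplike_monoidal_groupoid
begin

lemma Isom_eq_homs: "Isom C P Q = homs C P Q"
  using all_invertible by (auto simp: Isom_def homs_def)

lemma inverse_arrows_inv_arrow:
  assumes "u \<in> Arr C"
  shows "inverse_arrows C u (inv_arrow C u)"
proof -
  obtain v where "inverse_arrows C u v"
    using all_invertible[OF assms] by (auto simp: invertible_arrow_def)
  then show ?thesis
    unfolding inv_arrow_def using inverse_arrows_unique by (metis theI)
qed

lemma inv_arrow_simps [simp]:
  assumes "u \<in> Arr C"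
  shows "inv_arrow C u \<in> Arr C" "Src C (inv_arrow C u) = Tgt C u" "Tgt C (inv_arrow C u) = Src C u"
    "inv_arrow C u \<cdot> u = Ident C (Src C u)" "u \<cdot> inv_arrow C u = Ident C (Tgt C u)"
  using inverse_arrows_inv_arrow[OF assms] by (auto simp: inverse_arrows_def)

lemma inv_arrow_cancel [simp]:
  assumes "u \<in> Arr C" "v \<in> Arr C"
  shows "Src C u = Tgt C v \<Longrightarrow> inv_arrow C u \<cdot> (u \<cdot> v) = v"
    "Tgt C u = Tgt C v \<Longrightarrow> u \<cdot> (inv_arrow C u \<cdot> v) = v"
  using assms by (simp_all flip: Comp_assoc_Arr)

lemma Comp_left_cancel:
  assumes "w \<cdot> u = w \<cdot> v" "u \<in> Arr C" "v \<in> Arr C" "w \<in> Arr C" "Tgt C u = Src C w" "Tgt C v = Src C w"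
  shows "u = v"
proof -
  have "u = inv_arrow C w \<cdot> (w \<cdot> u)" using assms(2-) by simp
  also have "\<dots> = inv_arrow C w \<cdot> (w \<cdot> v)" by (simp only: assms(1))
  also have "\<dots> = v" using assms(2-) by simp
  finally show ?thesis .
qed

lemma Comp_right_cancel:
  assumes "u \<cdot> w = v \<cdot> w" "u \<in> Arr C" "v \<in> Arr C" "w \<in> Arr C" "Src C u = Tgt C w" "Src C v = Tgt C w"
  shows "u = v"
proof -
  have "u = (u \<cdot> w) \<cdot> inv_arrow C w" using assms(2-) by (simp add: Comp_assoc_Arr)
  also have "\<dots> = (v \<cdot> w) \<cdot> inv_arrow C w" by (simp only: assms(1))
  also have "\<dots> = v" using assms(2-) by (simp add: Comp_assoc_Arr)
  finally show ?thesis .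
qed

text \<open>Naturality of \<open>Lunit\<close> conjugates tensoring with the unit object to the
  identity functor. \<open>Lunit_TenO\<close> relies on this to be proved after tensoring both sides
  with the unit.\<close>

lemma TenA_Unit_left_cancel:
  assumes "Ident C (Unit C) \<boxtimes> u = Ident C (Unit C) \<boxtimes> v"
    "u \<in> Arr C" "v \<in> Arr C" "Src C u = Src C v" "Tgt C u = Tgt C v"
  shows "u = v"
proof (rule Comp_right_cancel)
  show "u \<cdot> Lunit C (Src C u) = v \<cdot> Lunit C (Src C u)"
    using Lunit_natural_Arr[of u] Lunit_natural_Arr[of v] assms by simp
qed (use assms in simp_all)

lemma TenA_Unit_right_cancel:
  assumes "u \<boxtimes> Ident C (Unit C) = v \<boxtimes> Ident C (Unit C)"
    "u \<in> Arr C" "v \<in> Arr C" "Src C u = Src C v" "Tgt C u = Tgt C v"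
  shows "u = v"
proof (rule Comp_right_cancel)
  show "u \<cdot> Runit C (Src C u) = v \<cdot> Runit C (Src C u)"
    using Runit_natural_Arr[of u] Runit_natural_Arr[of v] assms by simp
qed (use assms in simp_all)

text \<open>Kelly's coherence lemma: both sides agree after tensoring with the unit object, by the
  pentagon for \<open>I(I(PQ))\<close>.\<close>

lemma Lunit_TenO:
  assumes P: "P \<in> Obj C" and Q: "Q \<in> Obj C"
  shows "Lunit C (P \<boxdot> Q) = (Lunit C P \<boxtimes> Ident C Q) \<cdot> Assoc C (Unit C) P Q"
proof (rule TenA_Unit_left_cancel)
  let ?I = "Unit C" and ?i = "Ident C (Unit C)"
  let ?r = "(Runit C ?I \<boxtimes> Ident C P) \<boxtimes> Ident C Q"
  have "?r \<cdot> (Assoc C (?I \<boxdot> ?I) P Q \<cdot> Assoc C ?I ?I (P \<boxdot> Q)) =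
      (?r \<cdot> Assoc C (?I \<boxdot> ?I) P Q) \<cdot> Assoc C ?I ?I (P \<boxdot> Q)"
    using P Q by (simp add: Comp_assoc_Arr)
  also have "?r \<cdot> Assoc C (?I \<boxdot> ?I) P Q =
      Assoc C ?I P Q \<cdot> (Runit C ?I \<boxtimes> (Ident C P \<boxtimes> Ident C Q))"
    using Assoc_natural_Arr[of "Runit C ?I" "Ident C P" "Ident C Q"] P Q by simp
  also have "(Assoc C ?I P Q \<cdot> (Runit C ?I \<boxtimes> (Ident C P \<boxtimes> Ident C Q))) \<cdot> Assoc C ?I ?I (P \<boxdot> Q) =
      Assoc C ?I P Q \<cdot> (?i \<boxtimes> Lunit C (P \<boxdot> Q))"
    using P Q triangle[of ?I "P \<boxdot> Q"] by (simp add: Comp_assoc_Arr TenA_Ident)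
  finally have 1: "?r \<cdot> (Assoc C (?I \<boxdot> ?I) P Q \<cdot> Assoc C ?I ?I (P \<boxdot> Q)) =
      Assoc C ?I P Q \<cdot> (?i \<boxtimes> Lunit C (P \<boxdot> Q))" .
  have "?r \<cdot> ((Assoc C ?I ?I P \<boxtimes> Ident C Q) \<cdot> Assoc C ?I (?I \<boxdot> P) Q \<cdot> (?i \<boxtimes> Assoc C ?I P Q)) =
      ((?r \<cdot> (Assoc C ?I ?I P \<boxtimes> Ident C Q)) \<cdot> Assoc C ?I (?I \<boxdot> P) Q) \<cdot> (?i \<boxtimes> Assoc C ?I P Q)"
    using P Q by (simp add: Comp_assoc_Arr)
  also have "?r \<cdot> (Assoc C ?I ?I P \<boxtimes> Ident C Q) = (?i \<boxtimes> Lunit C P) \<boxtimes> Ident C Q"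
    using P Q triangle[of ?I P] by (simp add: TenA_Comp_Arr)
  also have "((?i \<boxtimes> Lunit C P) \<boxtimes> Ident C Q) \<cdot> Assoc C ?I (?I \<boxdot> P) Q =
      Assoc C ?I P Q \<cdot> (?i \<boxtimes> (Lunit C P \<boxtimes> Ident C Q))"
    using Assoc_natural_Arr[of ?i "Lunit C P" "Ident C Q"] P Q by simp
  also have "(Assoc C ?I P Q \<cdot> (?i \<boxtimes> (Lunit C P \<boxtimes> Ident C Q))) \<cdot> (?i \<boxtimes> Assoc C ?I P Q) =
      Assoc C ?I P Q \<cdot> (?i \<boxtimes> ((Lunit C P \<boxtimes> Ident C Q) \<cdot> Assoc C ?I P Q))"
    using P Q by (simp add: Comp_assoc_Arr TenA_Comp_Arr)
  finally have "Assoc C ?I P Q \<cdot> (?i \<boxtimes> Lunit C (P \<boxdot> Q)) =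
      Assoc C ?I P Q \<cdot> (?i \<boxtimes> ((Lunit C P \<boxtimes> Ident C Q) \<cdot> Assoc C ?I P Q))"
    using 1 pentagon[of ?I ?I P Q] P Q by simp
  then show "?i \<boxtimes> Lunit C (P \<boxdot> Q) = ?i \<boxtimes> ((Lunit C P \<boxtimes> Ident C Q) \<cdot> Assoc C ?I P Q)"
    by (rule Comp_left_cancel) (use P Q in simp_all)
qed (use P Q in simp_all)

section \<open>Tensoring with an invertible object is fully faithful\<close>

lemma invertible_objectE:
  assumes "P \<in> Obj C"
  obtains Q e where "Q \<in> Obj C" "e \<in> Arr C" "Src C e = P \<boxdot> Q" "Tgt C e = Unit C"
proof -
  obtain Q where "Q \<in> Obj C" "isomorphic C (P \<boxdot> Q) (Unit C)"
    using object_invertible[OF assms] by blast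
  then show thesis
    using that by (auto simp: isomorphic_def Isom_def homs_def)
qed

text \<open>Up to \<open>Assoc\<close> and \<open>e\<close>, tensoring with \<open>P\<close> and
  then with \<open>Q\<close> is tensoring with the unit object, which is faithful. Faithfulness of
  tensoring with \<open>P\<close> follows by tensoring an equation once more with
  \<open>Q\<close>.\<close>

lemma TenA_right_cancel_of_iso_Unit:
  assumes uv: "(u \<boxtimes> Ident C P) \<boxtimes> Ident C Q = (v \<boxtimes> Ident C P) \<boxtimes> Ident C Q"
    and u: "u \<in> Arr C" "v \<in> Arr C" "Src C u = Src C v" "Tgt C u = Tgt C v"
    and P: "P \<in> Obj C" "Q \<in> Obj C" and e: "e \<in> Arr C" "Src C e = P \<boxdot> Q" "Tgt C e = Unit C"
  shows "u = v"
proof -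
  let ?a = "\<lambda>R. Assoc C R P Q"
  have "?a (Tgt C u) \<cdot> (u \<boxtimes> Ident C (P \<boxdot> Q)) = ?a (Tgt C u) \<cdot> (v \<boxtimes> Ident C (P \<boxdot> Q))"
    using Assoc_natural_Arr[of u "Ident C P" "Ident C Q"] Assoc_natural_Arr[of v "Ident C P" "Ident C Q"]
      u P uv by (simp add: TenA_Ident)
  then have "u \<boxtimes> Ident C (P \<boxdot> Q) = v \<boxtimes> Ident C (P \<boxdot> Q)"
    by (rule Comp_left_cancel) (use u P in simp_all)
  then have "(Ident C (Tgt C u) \<boxtimes> e) \<cdot> (u \<boxtimes> Ident C (P \<boxdot> Q)) =
      (Ident C (Tgt C v) \<boxtimes> e) \<cdot> (v \<boxtimes> Ident C (P \<boxdot> Q))"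
    using u by simp
  then have "u \<boxtimes> e = v \<boxtimes> e"
    using u e P by (simp add: TenA_Comp_Arr)
  then have "(u \<boxtimes> Ident C (Unit C)) \<cdot> (Ident C (Src C u) \<boxtimes> e) =
      (v \<boxtimes> Ident C (Unit C)) \<cdot> (Ident C (Src C u) \<boxtimes> e)"
    using u e by (simp add: TenA_Comp_Arr)
  then have "u \<boxtimes> Ident C (Unit C) = v \<boxtimes> Ident C (Unit C)"
    by (rule Comp_right_cancel) (use u e in simp_all)
  then show ?thesis
    by (rule TenA_Unit_right_cancel) (use u in simp_all)
qed

lemma TenA_right_cancel:
  assumes "u \<boxtimes> Ident C P = v \<boxtimes> Ident C P" "P \<in> Obj C"
    "u \<in> Arr C" "v \<in> Arr C" "Src C u = Src C v" "Tgt C u = Tgt C v"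
  shows "u = v"
proof -
  obtain Q e where "Q \<in> Obj C" "e \<in> Arr C" "Src C e = P \<boxdot> Q" "Tgt C e = Unit C"
    using assms(2) by (rule invertible_objectE)
  then show ?thesis
    using TenA_right_cancel_of_iso_Unit[of u P Q v e] assms by simp
qed

text \<open>Tensoring with \<open>Q\<close> is a quasi-inverse of tensoring with \<open>P\<close>, so the latter is full.\<close>

lemma TenA_right_full:
  assumes P: "P \<in> Obj C" "R \<in> Obj C" "S \<in> Obj C" and h: "h \<in> homs C (R \<boxdot> P) (S \<boxdot> P)"
  obtains u where "u \<in> homs C R S" "u \<boxtimes> Ident C P = h"
proof -
  obtain Q e where Q: "Q \<in> Obj C" and e: "e \<in> Arr C" "Src C e = P \<boxdot> Q" "Tgt C e = Unit C"
    using P(1) by (rule invertible_objectE)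
  \<comment> \<open>The isomorphism from \<open>(TP)Q\<close> to \<open>T\<close> through
    \<open>T(PQ)\<close> and \<open>TI\<close>. Its naturality exhibits tensoring with
    \<open>Q\<close> as a quasi-inverse.\<close>
  define t where "t T = Runit C T \<cdot> (Ident C T \<boxtimes> e) \<cdot> inv_arrow C (Assoc C T P Q)" for T
  have t [simp]: "t T \<in> Arr C" "Src C (t T) = (T \<boxdot> P) \<boxdot> Q" "Tgt C (t T) = T" if "T \<in> Obj C" for T
    using that e P Q by (simp_all add: t_def)
  have t_natural: "t (Tgt C u) \<cdot> ((u \<boxtimes> Ident C P) \<boxtimes> Ident C Q) = u \<cdot> t (Src C u)" if u: "u \<in> Arr C" for u
  proof (rule Comp_right_cancel)
    show "(t (Tgt C u) \<cdot> ((u \<boxtimes> Ident C P) \<boxtimes> Ident C Q)) \<cdot> Assoc C (Src C u) P Q =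
        (u \<cdot> t (Src C u)) \<cdot> Assoc C (Src C u) P Q"
    proof -
      have "(t (Tgt C u) \<cdot> ((u \<boxtimes> Ident C P) \<boxtimes> Ident C Q)) \<cdot> Assoc C (Src C u) P Q =
        t (Tgt C u) \<cdot> (((u \<boxtimes> Ident C P) \<boxtimes> Ident C Q) \<cdot> Assoc C (Src C u) P Q)"
        using u P Q by (simp add: Comp_assoc_Arr)
      also have "\<dots> = t (Tgt C u) \<cdot> (Assoc C (Tgt C u) P Q \<cdot> (u \<boxtimes> Ident C (P \<boxdot> Q)))"
        using Assoc_natural_Arr[of u "Ident C P" "Ident C Q"] u P Q by (simp add: TenA_Ident)
      also have "\<dots> = Runit C (Tgt C u) \<cdot> ((Ident C (Tgt C u) \<boxtimes> e) \<cdot> (u \<boxtimes> Ident C (P \<boxdot> Q)))"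
        using u P Q e by (simp add: t_def Comp_assoc_Arr)
      also have "\<dots> = Runit C (Tgt C u) \<cdot> ((u \<boxtimes> Ident C (Unit C)) \<cdot> (Ident C (Src C u) \<boxtimes> e))"
        using u P Q e by (simp add: TenA_Comp_Arr)
      also have "\<dots> = (Runit C (Tgt C u) \<cdot> (u \<boxtimes> Ident C (Unit C))) \<cdot> (Ident C (Src C u) \<boxtimes> e)"
        using u P Q e by (simp add: Comp_assoc_Arr)
      also have "\<dots> = (u \<cdot> t (Src C u)) \<cdot> Assoc C (Src C u) P Q"
        using u P Q e by (simp add: t_def Comp_assoc_Arr Runit_natural_Arr)
      finally show ?thesis .
    qed
  qed (use u P Q in simp_all)
  \<comment> \<open>The only candidate: \<open>t_natural\<close> forces this value on any
    \<open>u\<close> with \<open>u \<boxtimes> Ident C P = h\<close>. That it works needs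
    faithfulness of tensoring with \<open>Q\<close>, which strips \<open>Q\<close> from the
    resulting equation.\<close>
  define u where "u = t S \<cdot> (h \<boxtimes> Ident C Q) \<cdot> inv_arrow C (t R)"
  have h': "h \<in> Arr C" "Src C h = R \<boxdot> P" "Tgt C h = S \<boxdot> P"
    using h by (auto simp: homs_def)
  have u: "u \<in> Arr C" "Src C u = R" "Tgt C u = S"
    using P Q h' by (simp_all add: u_def)
  have "t S \<cdot> ((u \<boxtimes> Ident C P) \<boxtimes> Ident C Q) = t S \<cdot> (h \<boxtimes> Ident C Q)"
    using t_natural[of u] u P Q h' by (simp add: u_def Comp_assoc_Arr)
  then have "(u \<boxtimes> Ident C P) \<boxtimes> Ident C Q = h \<boxtimes> Ident C Q"
    by (rule Comp_left_cancel) (use P Q u h' in simp_all)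
  then have "u \<boxtimes> Ident C P = h"
    by (rule TenA_right_cancel) (use P Q u h' in simp_all)
  then show thesis
    using that[of u] u by (simp add: homs_def)
qed

section \<open>Automorphisms of an object induced by those of the unit object\<close>

lemma aut_left_simps [simp]:
  assumes "P \<in> Obj C" "a \<in> homs C (Unit C) (Unit C)"
  shows "aut_left C P a \<in> Arr C" "Src C (aut_left C P a) = P" "Tgt C (aut_left C P a) = P"
  using assms by (auto simp: aut_left_def homs_def)

lemma aut_left_Lunit:
  assumes "P \<in> Obj C" "a \<in> homs C (Unit C) (Unit C)"
  shows "aut_left C P a \<cdot> Lunit C P = Lunit C P \<cdot> (a \<boxtimes> Ident C P)"
  using assms by (auto simp: aut_left_def homs_def Comp_assoc_Arr)

lemma aut_right_simps [simp]:
  assumes "P \<in> Obj C" "a \<in> homs C (Unit C) (Unit C)"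
  shows "aut_right C P a \<in> Arr C" "Src C (aut_right C P a) = P" "Tgt C (aut_right C P a) = P"
  using assms by (auto simp: aut_right_def homs_def)

lemma aut_right_Runit:
  assumes "P \<in> Obj C" "a \<in> homs C (Unit C) (Unit C)"
  shows "aut_right C P a \<cdot> Runit C P = Runit C P \<cdot> (Ident C P \<boxtimes> a)"
  using assms by (auto simp: aut_right_def homs_def Comp_assoc_Arr)

text \<open>Automorphisms are compared after precomposition with \<open>Lunit\<close>, where
  \<open>aut_left\<close> becomes plain \<open>a \<boxtimes> Ident C P\<close> and functoriality of
  the tensor product applies.\<close>

lemma aut_left_Comp:
  assumes P: "P \<in> Obj C" and a: "a \<in> homs C (Unit C) (Unit C)" and b: "b \<in> homs C (Unit C) (Unit C)"
  shows "aut_left C P (a \<cdot> b) = aut_left C P a \<cdot> aut_left C P b"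
proof (rule Comp_right_cancel)
  have ab: "a \<cdot> b \<in> homs C (Unit C) (Unit C)"
    using Comp_closed[OF b a] .
  have "(aut_left C P a \<cdot> aut_left C P b) \<cdot> Lunit C P = aut_left C P a \<cdot> (Lunit C P \<cdot> (b \<boxtimes> Ident C P))"
    using assms by (simp add: Comp_assoc_Arr aut_left_Lunit)
  also have "\<dots> = (aut_left C P a \<cdot> Lunit C P) \<cdot> (b \<boxtimes> Ident C P)"
    using assms by (subst Comp_assoc_Arr) (auto simp: homs_def)
  also have "\<dots> = Lunit C P \<cdot> ((a \<cdot> b) \<boxtimes> Ident C P)"
    using assms aut_left_Lunit[OF P a] by (auto simp: homs_def Comp_assoc_Arr TenA_Comp_Arr)
  finally show "aut_left C P (a \<cdot> b) \<cdot> Lunit C P = (aut_left C P a \<cdot> aut_left C P b) \<cdot> Lunit C P"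
    using aut_left_Lunit[OF P ab] by simp
qed (use assms Comp_closed[OF b a] in simp_all)

lemma aut_left_Ident: "P \<in> Obj C \<Longrightarrow> aut_left C P (Ident C (Unit C)) = Ident C P"
  by (simp add: aut_left_def TenA_Ident)

text \<open>Precomposed with \<open>Lunit\<close>, both sides are \<open>a \<boxtimes> u\<close>
  followed by \<open>Lunit\<close>: the scalar acts on the unit factor and \<open>u\<close> on the
  other, so they commute.\<close>

lemma aut_left_natural:
  assumes u: "u \<in> Arr C" and a: "a \<in> homs C (Unit C) (Unit C)"
  shows "u \<cdot> aut_left C (Src C u) a = aut_left C (Tgt C u) a \<cdot> u"
proof (rule Comp_right_cancel)
  have a': "a \<in> Arr C" "Src C a = Unit C" "Tgt C a = Unit C"
    using a by (auto simp: homs_def)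
  have "(u \<cdot> aut_left C (Src C u) a) \<cdot> Lunit C (Src C u) =
      (u \<cdot> Lunit C (Src C u)) \<cdot> (a \<boxtimes> Ident C (Src C u))"
    using u a a' by (simp add: Comp_assoc_Arr aut_left_Lunit)
  also have "\<dots> = Lunit C (Tgt C u) \<cdot> (a \<boxtimes> u)"
    using u a' by (simp add: Comp_assoc_Arr TenA_Comp_Arr flip: Lunit_natural_Arr)
  also have "\<dots> = (Lunit C (Tgt C u) \<cdot> (a \<boxtimes> Ident C (Tgt C u))) \<cdot> (Ident C (Unit C) \<boxtimes> u)"
    using u a' by (simp add: Comp_assoc_Arr TenA_Comp_Arr)
  also have "\<dots> = aut_left C (Tgt C u) a \<cdot> (Lunit C (Tgt C u) \<cdot> (Ident C (Unit C) \<boxtimes> u))"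
    using u a a' by (simp flip: aut_left_Lunit add: Comp_assoc_Arr)
  also have "\<dots> = (aut_left C (Tgt C u) a \<cdot> u) \<cdot> Lunit C (Src C u)"
    using u a by (simp add: Lunit_natural_Arr Comp_assoc_Arr)
  finally show "(u \<cdot> aut_left C (Src C u) a) \<cdot> Lunit C (Src C u) =
      (aut_left C (Tgt C u) a \<cdot> u) \<cdot> Lunit C (Src C u)" .
qed (use assms in simp_all)

text \<open>Kelly's lemma \<open>Lunit_TenO\<close> enters here: the two sides are defined by the
  unit constraints of \<open>P\<close> and of \<open>P \<boxdot> Q\<close>, which have to be
  compared.\<close>

lemma aut_left_TenA_Ident:
  assumes P: "P \<in> Obj C" and Q: "Q \<in> Obj C" and a: "a \<in> homs C (Unit C) (Unit C)"
  shows "aut_left C P a \<boxtimes> Ident C Q = aut_left C (P \<boxdot> Q) a"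
proof (rule Comp_right_cancel)
  let ?a = "Assoc C (Unit C) P Q"
  have a': "a \<in> Arr C" "Src C a = Unit C" "Tgt C a = Unit C"
    using a by (auto simp: homs_def)
  have "(aut_left C P a \<boxtimes> Ident C Q) \<cdot> Lunit C (P \<boxdot> Q) =
      ((aut_left C P a \<boxtimes> Ident C Q) \<cdot> (Lunit C P \<boxtimes> Ident C Q)) \<cdot> ?a"
    using P Q a by (simp add: Lunit_TenO Comp_assoc_Arr)
  also have "(aut_left C P a \<boxtimes> Ident C Q) \<cdot> (Lunit C P \<boxtimes> Ident C Q) =
      (Lunit C P \<boxtimes> Ident C Q) \<cdot> ((a \<boxtimes> Ident C P) \<boxtimes> Ident C Q)"
    using P Q a a' by (simp add: TenA_Comp_Arr aut_left_Lunit)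
  also have "\<dots> \<cdot> ?a = (Lunit C P \<boxtimes> Ident C Q) \<cdot> (?a \<cdot> (a \<boxtimes> Ident C (P \<boxdot> Q)))"
    using P Q a' Assoc_natural_Arr[of a "Ident C P" "Ident C Q"] by (simp add: Comp_assoc_Arr TenA_Ident)
  also have "\<dots> = Lunit C (P \<boxdot> Q) \<cdot> (a \<boxtimes> Ident C (P \<boxdot> Q))"
    using P Q a' by (simp add: Comp_assoc_Arr Lunit_TenO)
  also have "\<dots> = aut_left C (P \<boxdot> Q) a \<cdot> Lunit C (P \<boxdot> Q)"
    using P Q a by (simp add: aut_left_Lunit)
  finally show "(aut_left C P a \<boxtimes> Ident C Q) \<cdot> Lunit C (P \<boxdot> Q) =
      aut_left C (P \<boxdot> Q) a \<cdot> Lunit C (P \<boxdot> Q)" .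
qed (use assms in simp_all)

text \<open>The triangle axiom moves a scalar standing between \<open>P\<close> and \<open>Q\<close>
  from the left of \<open>Q\<close> to the right of \<open>P\<close>. This is how the action on A
  enters tensor products.\<close>

lemma Ident_TenA_aut_left:
  assumes P: "P \<in> Obj C" and Q: "Q \<in> Obj C" and a: "a \<in> homs C (Unit C) (Unit C)"
  shows "Ident C P \<boxtimes> aut_left C Q a = aut_right C P a \<boxtimes> Ident C Q"
proof (rule Comp_right_cancel)
  let ?a = "Assoc C P (Unit C) Q"
  have a': "a \<in> Arr C" "Src C a = Unit C" "Tgt C a = Unit C"
    using a by (auto simp: homs_def)
  have "(Ident C P \<boxtimes> aut_left C Q a) \<cdot> (Ident C P \<boxtimes> Lunit C Q) =
      (Ident C P \<boxtimes> Lunit C Q) \<cdot> (Ident C P \<boxtimes> (a \<boxtimes> Ident C Q))"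
    using P Q a a' by (simp add: TenA_Comp_Arr aut_left_Lunit)
  also have "\<dots> = (Runit C P \<boxtimes> Ident C Q) \<cdot> (?a \<cdot> (Ident C P \<boxtimes> (a \<boxtimes> Ident C Q)))"
    using P Q a' by (simp add: Comp_assoc_Arr flip: triangle)
  also have "\<dots> = ((Runit C P \<boxtimes> Ident C Q) \<cdot> ((Ident C P \<boxtimes> a) \<boxtimes> Ident C Q)) \<cdot> ?a"
    using P Q a' Assoc_natural_Arr[of "Ident C P" a "Ident C Q"] by (simp add: Comp_assoc_Arr)
  also have "(Runit C P \<boxtimes> Ident C Q) \<cdot> ((Ident C P \<boxtimes> a) \<boxtimes> Ident C Q) =
      (aut_right C P a \<boxtimes> Ident C Q) \<cdot> (Runit C P \<boxtimes> Ident C Q)"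
    using P Q a a' by (simp add: TenA_Comp_Arr aut_right_Runit)
  also have "\<dots> \<cdot> ?a = (aut_right C P a \<boxtimes> Ident C Q) \<cdot> (Ident C P \<boxtimes> Lunit C Q)"
    using P Q a by (simp add: Comp_assoc_Arr triangle)
  finally show "(Ident C P \<boxtimes> aut_left C Q a) \<cdot> (Ident C P \<boxtimes> Lunit C Q) =
      (aut_right C P a \<boxtimes> Ident C Q) \<cdot> (Ident C P \<boxtimes> Lunit C Q)" .
qed (use assms in simp_all)

text \<open>Injective because tensoring with \<open>P\<close> is faithful, surjective because it is
  full. This justifies identifying every automorphism group with that of the unit.\<close>

lemma bij_betw_aut_left:
  assumes P: "P \<in> Obj C"
  shows "bij_betw (aut_left C P) (homs C (Unit C) (Unit C)) (homs C P P)"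
proof (rule bij_betw_imageI)
  show "inj_on (aut_left C P) (homs C (Unit C) (Unit C))"
  proof (rule inj_onI)
    fix a b
    assume ab: "a \<in> homs C (Unit C) (Unit C)" "b \<in> homs C (Unit C) (Unit C)"
      "aut_left C P a = aut_left C P b"
    then have "Lunit C P \<cdot> (a \<boxtimes> Ident C P) = Lunit C P \<cdot> (b \<boxtimes> Ident C P)"
      using P by (simp flip: aut_left_Lunit)
    then have "a \<boxtimes> Ident C P = b \<boxtimes> Ident C P"
      by (rule Comp_left_cancel) (use P ab in \<open>auto simp: homs_def\<close>)
    then show "a = b"
      by (rule TenA_right_cancel) (use P ab in \<open>auto simp: homs_def\<close>)
  qed
  show "aut_left C P ` homs C (Unit C) (Unit C) = homs C P P"
  proof (intro equalityI subsetI)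
    fix h assume h: "h \<in> homs C P P"
    let ?k = "inv_arrow C (Lunit C P) \<cdot> (h \<cdot> Lunit C P)"
    have "?k \<in> homs C (Unit C \<boxdot> P) (Unit C \<boxdot> P)"
      using h P by (auto simp: homs_def)
    then obtain a where a: "a \<in> homs C (Unit C) (Unit C)" "a \<boxtimes> Ident C P = ?k"
      using TenA_right_full[of P "Unit C" "Unit C" ?k] P by auto
    have "aut_left C P a = h"
      unfolding aut_left_def a(2) using h P by (auto simp: homs_def Comp_assoc_Arr)
    then show "h \<in> aut_left C P ` homs C (Unit C) (Unit C)"
      using a(1) by blast
  next
    fix h assume "h \<in> aut_left C P ` homs C (Unit C) (Unit C)"
    then show "h \<in> homs C P P"
      using P by (auto simp: homs_def[of C P])
  qed
qed

text \<open>\<open>pi0_action\<close> is an \<open>inv_into\<close>, which carries information only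
  if \<open>aut_right C P a\<close> lies in the range of \<open>aut_left C P\<close>; surjectivity
  of the latter provides this.\<close>

lemma trivial_pi0_actionD:
  assumes "trivial_pi0_action C" "P \<in> Obj C" "a \<in> homs C (Unit C) (Unit C)"
  shows "aut_right C P a = aut_left C P a"
proof -
  have "aut_right C P a \<in> aut_left C P ` homs C (Unit C) (Unit C)"
    using assms(2,3) bij_betw_aut_left[OF assms(2)]
    by (auto simp: bij_betw_def homs_def[of C P])
  then have "aut_left C P (pi0_action C P a) = aut_right C P a"
    unfolding pi0_action_def by (intro f_inv_into_f) (simp add: Aut_def Isom_eq_homs)
  then show ?thesis
    using assms by (simp add: trivial_pi0_action_def Aut_def Isom_eq_homs)
qed

lemma group_Aut:
  assumes "P \<in> Obj C"
  shows "group (Aut C P)"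
proof (rule groupI)
  fix u assume "u \<in> carrier (Aut C P)"
  then show "\<exists>v\<in>carrier (Aut C P). v \<otimes>\<^bsub>Aut C P\<^esub> u = \<one>\<^bsub>Aut C P\<^esub>"
    using assms by (intro bexI[of _ "inv_arrow C u"]) (auto simp: Aut_def Isom_eq_homs homs_def)
qed (use assms in \<open>auto simp: Aut_def Isom_eq_homs homs_def Comp_assoc_Arr\<close>)

end

section \<open>Three-cocycles on an abelian group\<close>

locale abelian_3_cocycle = A: comm_group A + B: comm_group B
  for A :: "'a monoid" and B :: "'b monoid" +
  fixes f :: "'b \<Rightarrow> 'b \<Rightarrow> 'b \<Rightarrow> 'a"
  assumes f_closed [simp]: "\<lbrakk>x \<in> carrier B; y \<in> carrier B; z \<in> carrier B\<rbrakk> \<Longrightarrow> f x y z \<in> carrier A"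
    and f_cocycle: "\<lbrakk>w \<in> carrier B; x \<in> carrier B; y \<in> carrier B; z \<in> carrier B\<rbrakk> \<Longrightarrow>
      f (w \<otimes>\<^bsub>B\<^esub> x) y z \<otimes>\<^bsub>A\<^esub> f w x (y \<otimes>\<^bsub>B\<^esub> z) = f w x y \<otimes>\<^bsub>A\<^esub> f w (x \<otimes>\<^bsub>B\<^esub> y) z \<otimes>\<^bsub>A\<^esub> f x y z"
begin

text \<open>Identities between products of values of \<open>f\<close> are proved in the additive free abelian
  group on \<open>B\<^sup>3\<close>, where the simplifier normalizes them, and then mapped to \<open>A\<close>.\<close>

definition words :: "('b \<times> 'b \<times> 'b \<Rightarrow>\<^sub>0 int) set" where
  "words = carrier (free_Abelian_group (triples B))"

definition value_hom :: "('b \<times> 'b \<times> 'b \<Rightarrow>\<^sub>0 int) \<Rightarrow> 'a" where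
  "value_hom = (SOME h. h \<in> hom (free_Abelian_group (triples B)) A \<and>
     (\<forall>x \<in> carrier B. \<forall>y \<in> carrier B. \<forall>z \<in> carrier B. h (frag_of (x, y, z)) = f x y z))"

lemma value_hom:
  "value_hom \<in> hom (free_Abelian_group (triples B)) A"
  "\<lbrakk>x \<in> carrier B; y \<in> carrier B; z \<in> carrier B\<rbrakk> \<Longrightarrow> value_hom (frag_of (x, y, z)) = f x y z"
proof -
  have "(\<lambda>(x, y, z). f x y z) ` triples B \<subseteq> carrier A"
    by (auto simp: triples_def)
  then obtain h where "h \<in> hom (free_Abelian_group (triples B)) A"
    and "\<And>t. t \<in> triples B \<Longrightarrow> h (frag_of t) = (\<lambda>(x, y, z). f x y z) t"
    by (rule A.free_Abelian_group_universal) blast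
  then have "\<exists>h. h \<in> hom (free_Abelian_group (triples B)) A \<and>
     (\<forall>x \<in> carrier B. \<forall>y \<in> carrier B. \<forall>z \<in> carrier B. h (frag_of (x, y, z)) = f x y z)"
    by (intro exI[of _ h]) (auto simp: triples_def)
  from someI_ex[OF this]
  show "value_hom \<in> hom (free_Abelian_group (triples B)) A"
    "\<lbrakk>x \<in> carrier B; y \<in> carrier B; z \<in> carrier B\<rbrakk> \<Longrightarrow> value_hom (frag_of (x, y, z)) = f x y z"
    unfolding value_hom_def by blast+
qed

lemma words_simps [simp]:
  "\<lbrakk>x \<in> carrier B; y \<in> carrier B; z \<in> carrier B\<rbrakk> \<Longrightarrow> frag_of (x, y, z) \<in> words"
  "\<lbrakk>p \<in> words; q \<in> words\<rbrakk> \<Longrightarrow> p + q \<in> words"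
  "\<lbrakk>p \<in> words; q \<in> words\<rbrakk> \<Longrightarrow> p - q \<in> words"
  using keys_add[of p q] keys_diff[of p q] by (auto simp: words_def triples_def)

lemma value_hom_simps [simp]:
  "p \<in> words \<Longrightarrow> value_hom p \<in> carrier A"
  "\<lbrakk>p \<in> words; q \<in> words\<rbrakk> \<Longrightarrow> value_hom (p + q) = value_hom p \<otimes>\<^bsub>A\<^esub> value_hom q"
  "\<lbrakk>p \<in> words; q \<in> words\<rbrakk> \<Longrightarrow> value_hom (p - q) = value_hom p \<otimes>\<^bsub>A\<^esub> inv\<^bsub>A\<^esub> value_hom q"
proof -
  show 1: "value_hom p \<in> carrier A" if "p \<in> words" for p
    using that hom_in_carrier[OF value_hom(1)] by (auto simp: words_def)
  show 2: "value_hom (p + q) = value_hom p \<otimes>\<^bsub>A\<^esub> value_hom q" if "p \<in> words" "q \<in> words" for p q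
    using that hom_mult[OF value_hom(1)] by (auto simp: words_def)
  show "value_hom (p - q) = value_hom p \<otimes>\<^bsub>A\<^esub> inv\<^bsub>A\<^esub> value_hom q" if "p \<in> words" "q \<in> words"
    using that 2[of "p - q" q] by (simp add: 1 A.inv_solve_right)
qed

declare value_hom(2) [simp]

definition relations :: "('b \<times> 'b \<times> 'b \<Rightarrow>\<^sub>0 int) set" where
  "relations = {p \<in> words. value_hom p = \<one>\<^bsub>A\<^esub>}"

lemma relations_add: "\<lbrakk>p \<in> relations; q \<in> relations\<rbrakk> \<Longrightarrow> p + q \<in> relations"
  and relations_diff: "\<lbrakk>p \<in> relations; q \<in> relations\<rbrakk> \<Longrightarrow> p - q \<in> relations"
  by (simp_all add: relations_def)

text \<open>An identity in A is reduced to exhibiting \<open>k\<close>: the equation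
  \<open>p = q + k\<close> is formal and holds in the free abelian group, whatever \<open>f\<close>
  is.\<close>

lemma value_hom_eqI:
  assumes "k \<in> relations" "p \<in> words" "q \<in> words" "p = q + k"
  shows "value_hom p = value_hom q"
  using assms by (simp add: relations_def)

text \<open>The boundary of [w|x|y|z] in the bar complex of B with trivial coefficients; the cocycle
  identity says that \<open>value_hom\<close> kills it.\<close>

definition coboundary :: "'b \<Rightarrow> 'b \<Rightarrow> 'b \<Rightarrow> 'b \<Rightarrow> ('b \<times> 'b \<times> 'b \<Rightarrow>\<^sub>0 int)" where
  "coboundary w x y z = frag_of (x, y, z) - frag_of (w \<otimes>\<^bsub>B\<^esub> x, y, z) + frag_of (w, x \<otimes>\<^bsub>B\<^esub> y, z)
     - frag_of (w, x, y \<otimes>\<^bsub>B\<^esub> z) + frag_of (w, x, y)"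

lemma coboundary_relations [simp]:
  assumes "w \<in> carrier B" "x \<in> carrier B" "y \<in> carrier B" "z \<in> carrier B"
  shows "coboundary w x y z \<in> relations"
proof -
  have "value_hom (coboundary w x y z) =
      (f w x y \<otimes>\<^bsub>A\<^esub> f w (x \<otimes>\<^bsub>B\<^esub> y) z \<otimes>\<^bsub>A\<^esub> f x y z) \<otimes>\<^bsub>A\<^esub>
      inv\<^bsub>A\<^esub> (f (w \<otimes>\<^bsub>B\<^esub> x) y z \<otimes>\<^bsub>A\<^esub> f w x (y \<otimes>\<^bsub>B\<^esub> z))"
    using assms by (simp add: coboundary_def A.inv_mult A.m_ac)
  then show ?thesis
    using assms by (simp add: relations_def f_cocycle) (simp add: coboundary_def)
qed

text \<open>The signed product over the three places where \<open>z\<close> can be inserted into the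
  ordered pair \<open>x\<close>, \<open>y\<close>: \<open>f\<close> on the shuffle product of [x|y]
  with [z].\<close>

definition kappa :: "'b \<Rightarrow> 'b \<Rightarrow> 'b \<Rightarrow> 'a" where
  "kappa x y z = f z x y \<otimes>\<^bsub>A\<^esub> f x y z \<otimes>\<^bsub>A\<^esub> inv\<^bsub>A\<^esub> f x z y"

definition kappa_word :: "'b \<Rightarrow> 'b \<Rightarrow> 'b \<Rightarrow> ('b \<times> 'b \<times> 'b \<Rightarrow>\<^sub>0 int)" where
  "kappa_word x y z = frag_of (z, x, y) + frag_of (x, y, z) - frag_of (x, z, y)"

lemma kappa_word_simps [simp]:
  assumes "x \<in> carrier B" "y \<in> carrier B" "z \<in> carrier B"
  shows "kappa_word x y z \<in> words" "value_hom (kappa_word x y z) = kappa x y z"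
  using assms by (simp_all add: kappa_word_def kappa_def)

lemma kappa_closed [simp]:
  "\<lbrakk>x \<in> carrier B; y \<in> carrier B; z \<in> carrier B\<rbrakk> \<Longrightarrow> kappa x y z \<in> carrier A"
  by (simp add: kappa_def)

text \<open>The relation is the signed sum of the coboundaries of all shuffles of \<open>w\<close> with \<open>x, y, z\<close>;
  for \<open>kappa_interchange\<close> below, of \<open>x, x'\<close> with \<open>y, y'\<close>.\<close>

lemma kappa_relation:
  assumes "x \<in> carrier B" "y \<in> carrier B" "z \<in> carrier B" "w \<in> carrier B"
  shows "kappa_word x y w + kappa_word (x \<otimes>\<^bsub>B\<^esub> y) z w - kappa_word y z w - kappa_word x (y \<otimes>\<^bsub>B\<^esub> z) w
    \<in> relations"
proof -
  have "kappa_word x y w + kappa_word (x \<otimes>\<^bsub>B\<^esub> y) z w - kappa_word y z w - kappa_word x (y \<otimes>\<^bsub>B\<^esub> z) w =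
    coboundary w x y z - coboundary x w y z + coboundary x y w z - coboundary x y z w"
    using assms by (simp add: coboundary_def kappa_word_def B.m_ac algebra_simps)
  then show ?thesis
    using assms by (simp add: relations_add relations_diff)
qed

lemma kappa_cocycle:
  assumes "x \<in> carrier B" "y \<in> carrier B" "z \<in> carrier B" "w \<in> carrier B"
  shows "kappa x y w \<otimes>\<^bsub>A\<^esub> kappa (x \<otimes>\<^bsub>B\<^esub> y) z w = kappa y z w \<otimes>\<^bsub>A\<^esub> kappa x (y \<otimes>\<^bsub>B\<^esub> z) w"
proof -
  have "value_hom (kappa_word x y w + kappa_word (x \<otimes>\<^bsub>B\<^esub> y) z w) =
      value_hom (kappa_word y z w + kappa_word x (y \<otimes>\<^bsub>B\<^esub> z) w)"
    by (rule value_hom_eqI[OF kappa_relation[of x y z w]]) (use assms in simp_all)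
  then show ?thesis
    using assms by simp
qed

lemma kappa_interchange:
  assumes "x \<in> carrier B" "x' \<in> carrier B" "y \<in> carrier B" "y' \<in> carrier B"
  shows "kappa x x' y \<otimes>\<^bsub>A\<^esub> kappa x x' y' \<otimes>\<^bsub>A\<^esub> (kappa y y' x \<otimes>\<^bsub>A\<^esub> kappa y y' x') =
    kappa x x' (y \<otimes>\<^bsub>B\<^esub> y') \<otimes>\<^bsub>A\<^esub> kappa y y' (x \<otimes>\<^bsub>B\<^esub> x')"
proof -
  let ?k = "coboundary x x' y y' - coboundary x y x' y' + coboundary x y y' x' + coboundary y x x' y'
    - coboundary y x y' x' + coboundary y y' x x'"
  have "value_hom (kappa_word x x' y + kappa_word x x' y' + (kappa_word y y' x + kappa_word y y' x')) =
    value_hom (kappa_word x x' (y \<otimes>\<^bsub>B\<^esub> y') + kappa_word y y' (x \<otimes>\<^bsub>B\<^esub> x'))"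
  proof (rule value_hom_eqI)
    show "?k \<in> relations"
      using assms by (simp add: relations_add relations_diff)
  qed (use assms in \<open>simp_all add: coboundary_def kappa_word_def B.m_ac algebra_simps\<close>)
  then show ?thesis
    using assms by simp
qed

text \<open>\<open>f\<close> on the signed sum of all six orderings of the arguments: the intended
  value of the homomorphism on \<open>wedge3 B x y z\<close>.\<close>

definition alt :: "'b \<Rightarrow> 'b \<Rightarrow> 'b \<Rightarrow> 'a" where
  "alt x y z = (f x y z \<otimes>\<^bsub>A\<^esub> f z x y \<otimes>\<^bsub>A\<^esub> f y z x) \<otimes>\<^bsub>A\<^esub> inv\<^bsub>A\<^esub> (f x z y \<otimes>\<^bsub>A\<^esub> f z y x \<otimes>\<^bsub>A\<^esub> f y x z)"

lemma alt_closed [simp]: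
  "\<lbrakk>x \<in> carrier B; y \<in> carrier B; z \<in> carrier B\<rbrakk> \<Longrightarrow> alt x y z \<in> carrier A"
  by (simp add: alt_def)

text \<open>The six orderings split by whether \<open>x\<close> or \<open>y\<close> comes first, and
  each half is a value of \<open>kappa\<close>.\<close>

lemma alt_eq_kappa:
  assumes "x \<in> carrier B" "y \<in> carrier B" "z \<in> carrier B"
  shows "alt x y z = kappa x y z \<otimes>\<^bsub>A\<^esub> inv\<^bsub>A\<^esub> kappa y x z"
  using assms by (simp add: alt_def kappa_def A.inv_mult A.m_ac)

text \<open>A cyclic shift only permutes the factors within the numerator and within the
  denominator. It carries multiplicativity from the first argument to the other two.\<close>

lemma alt_cyclic:
  assumes "x \<in> carrier B" "y \<in> carrier B" "z \<in> carrier B"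
  shows "alt x y z = alt y z x"
  using assms by (simp add: alt_def A.inv_mult A.m_ac)

text \<open>Exchanging two equal arguments turns the numerator into the denominator. Antisymmetry
  would only make the square trivial, which is too weak for a map on the exterior cube.\<close>

lemma alt_repeat:
  assumes "x \<in> carrier B" "y \<in> carrier B" "z \<in> carrier B" "x = y \<or> y = z \<or> x = z"
  shows "alt x y z = \<one>\<^bsub>A\<^esub>"
proof -
  have "f x y z \<otimes>\<^bsub>A\<^esub> f z x y \<otimes>\<^bsub>A\<^esub> f y z x = f x z y \<otimes>\<^bsub>A\<^esub> f z y x \<otimes>\<^bsub>A\<^esub> f y x z"
    using assms by (auto simp: A.m_ac)
  then show ?thesis
    using assms(1-3) by (simp add: alt_def)
qed

lemma alt_mult1:
  assumes "x \<in> carrier B" "x' \<in> carrier B" "y \<in> carrier B" "z \<in> carrier B"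
  shows "alt (x \<otimes>\<^bsub>B\<^esub> x') y z = alt x y z \<otimes>\<^bsub>A\<^esub> alt x' y z"
proof -
  let ?g = "\<lambda>a b. kappa_word a b z"
  let ?d = "\<lambda>a b c. ?g a b + ?g (a \<otimes>\<^bsub>B\<^esub> b) c - ?g b c - ?g a (b \<otimes>\<^bsub>B\<^esub> c)"
  have "value_hom (?g (x \<otimes>\<^bsub>B\<^esub> x') y - ?g y (x \<otimes>\<^bsub>B\<^esub> x')) =
      value_hom ((?g x y - ?g y x) + (?g x' y - ?g y x'))"
  proof (rule value_hom_eqI)
    \<comment> \<open>The 2-cocycle relation of \<open>kappa\<close>, summed with signs over the
      three places of \<open>y\<close> among \<open>x\<close>, \<open>x'\<close>. As B is
      commutative, the terms in which \<open>y\<close> is multiplied by \<open>x\<close> or by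
      \<open>x'\<close> cancel.\<close>
    show "?d x x' y - ?d x y x' + ?d y x x' \<in> relations"
      using assms by (intro relations_add relations_diff kappa_relation)
  qed (use assms in \<open>simp_all add: B.m_ac algebra_simps\<close>)
  then show ?thesis
    using assms by (simp add: alt_eq_kappa)
qed

lemma alt_mult2:
  assumes "x \<in> carrier B" "y \<in> carrier B" "y' \<in> carrier B" "z \<in> carrier B"
  shows "alt x (y \<otimes>\<^bsub>B\<^esub> y') z = alt x y z \<otimes>\<^bsub>A\<^esub> alt x y' z"
  using assms alt_mult1[of y y' z x] by (simp add: alt_cyclic[of x])

lemma alt_mult3:
  assumes "x \<in> carrier B" "y \<in> carrier B" "z \<in> carrier B" "z' \<in> carrier B"
  shows "alt x y (z \<otimes>\<^bsub>B\<^esub> z') = alt x y z \<otimes>\<^bsub>A\<^esub> alt x y z'"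
  using assms alt_mult1[of z z' x y] by (simp flip: alt_cyclic[of _ x y])

end

section \<open>Alternating maps and the exterior cube\<close>

lemma wedge3_relators_closed:
  assumes "monoid B"
  shows "wedge3_relators B \<subseteq> carrier (free_Abelian_group (triples B))"
proof -
  interpret B: monoid B by fact
  show ?thesis
    by (auto simp: wedge3_relators_def triples_def dest!: keys_diff[THEN subsetD])
qed

lemma exterior_cube_universal:
  fixes A :: "'a monoid" and B :: "'b monoid"
  assumes "comm_group A" "comm_group B"
    and closed: "\<And>x y z. \<lbrakk>x \<in> carrier B; y \<in> carrier B; z \<in> carrier B\<rbrakk> \<Longrightarrow> g x y z \<in> carrier A"
    and mult1: "\<And>x x' y z. \<lbrakk>x \<in> carrier B; x' \<in> carrier B; y \<in> carrier B; z \<in> carrier B\<rbrakk> \<Longrightarrow>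
      g (x \<otimes>\<^bsub>B\<^esub> x') y z = g x y z \<otimes>\<^bsub>A\<^esub> g x' y z"
    and mult2: "\<And>x y y' z. \<lbrakk>x \<in> carrier B; y \<in> carrier B; y' \<in> carrier B; z \<in> carrier B\<rbrakk> \<Longrightarrow>
      g x (y \<otimes>\<^bsub>B\<^esub> y') z = g x y z \<otimes>\<^bsub>A\<^esub> g x y' z"
    and mult3: "\<And>x y z z'. \<lbrakk>x \<in> carrier B; y \<in> carrier B; z \<in> carrier B; z' \<in> carrier B\<rbrakk> \<Longrightarrow>
      g x y (z \<otimes>\<^bsub>B\<^esub> z') = g x y z \<otimes>\<^bsub>A\<^esub> g x y z'"
    and repeat: "\<And>x y z. \<lbrakk>x \<in> carrier B; y \<in> carrier B; z \<in> carrier B; x = y \<or> y = z \<or> x = z\<rbrakk> \<Longrightarrow>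
      g x y z = \<one>\<^bsub>A\<^esub>"
  obtains \<phi> where "\<phi> \<in> hom (exterior_cube B) A"
    and "\<And>x y z. \<lbrakk>x \<in> carrier B; y \<in> carrier B; z \<in> carrier B\<rbrakk> \<Longrightarrow> \<phi> (wedge3 B x y z) = g x y z"
proof -
  interpret A: comm_group A by fact
  interpret B: comm_group B by fact
  let ?F = "free_Abelian_group (triples B)"
  interpret F: comm_group ?F by (rule abelian_free_Abelian_group)
  have "(\<lambda>(x, y, z). g x y z) ` triples B \<subseteq> carrier A"
    using closed by (auto simp: triples_def)
  then obtain h where h: "h \<in> hom ?F A"
    and h_triple: "\<And>t. t \<in> triples B \<Longrightarrow> h (frag_of t) = (\<lambda>(x, y, z). g x y z) t"
    by (rule A.free_Abelian_group_universal) blast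
  interpret h: group_hom ?F A h
    using h by unfold_locales
  have h_frag [simp]: "h (frag_of (x, y, z)) = g x y z"
    if "x \<in> carrier B" "y \<in> carrier B" "z \<in> carrier B" for x y z
    using h_triple[of "(x, y, z)"] that by (simp add: triples_def)
  have h_diff: "h (p - q) = h p \<otimes>\<^bsub>A\<^esub> inv\<^bsub>A\<^esub> h q" if "p \<in> carrier ?F" "q \<in> carrier ?F" for p q
    using h.hom_mult[of p "inv\<^bsub>?F\<^esub> q"] h.hom_inv[of q] that by simp
  have diff_closed: "p - q \<in> carrier ?F" if "p \<in> carrier ?F" "q \<in> carrier ?F" for p q
    using that keys_diff[of p q] by auto
  have frag_closed: "frag_of (x, y, z) \<in> carrier ?F"
    if "x \<in> carrier B" "y \<in> carrier B" "z \<in> carrier B" for x y z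
    using that by (simp add: triples_def)
  \<comment> \<open>The three families of trilinearity relators all have the shape
    \<open>p - q - r\<close>, so one computation covers them.\<close>
  have trilinear: "h (p - q - r) = \<one>\<^bsub>A\<^esub>"
    if "p \<in> carrier ?F" "q \<in> carrier ?F" "r \<in> carrier ?F" "h p = h q \<otimes>\<^bsub>A\<^esub> h r" for p q r
  proof -
    have "h (p - q - r) = h q \<otimes>\<^bsub>A\<^esub> h r \<otimes>\<^bsub>A\<^esub> inv\<^bsub>A\<^esub> h q \<otimes>\<^bsub>A\<^esub> inv\<^bsub>A\<^esub> h r"
      using that(1-3) by (simp only: h_diff diff_closed that(4))
    also have "\<dots> = \<one>\<^bsub>A\<^esub>"
      using h.hom_closed[OF that(2)] h.hom_closed[OF that(3)]
      by (metis A.inv_closed A.inv_solve_right A.l_one A.m_closed A.m_comm A.m_assoc A.r_inv)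
    finally show ?thesis .
  qed
  have relators: "r \<in> carrier ?F \<and> h r = \<one>\<^bsub>A\<^esub>" if "r \<in> wedge3_relators B" for r
  proof
    show "r \<in> carrier ?F"
      using that wedge3_relators_closed[OF B.monoid_axioms] by blast
    show "h r = \<one>\<^bsub>A\<^esub>"
      using that unfolding wedge3_relators_def
      by (elim UnE CollectE exE conjE)
        (simp_all del: carrier_free_Abelian_group_iff frag_of_in_free_Abelian_group
          add: trilinear frag_closed mult1 mult2 mult3 repeat)
  qed
  have normal: "wedge3_relations B \<lhd> ?F"
    unfolding wedge3_relations_def
    using relators by (intro F.subgroup_imp_normal F.generate_is_subgroup) blast
  have "wedge3_relations B \<subseteq> kernel ?F A h"
    unfolding wedge3_relations_def
    using relators by (intro F.generate_subgroup_incl h.subgroup_kernel) (auto simp: kernel_def)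
  \<comment> \<open>\<open>FactGroup_universal\<close> asks that \<open>h\<close> be constant on
    cosets, so the inclusion of the relations in the kernel is restated for cosets.\<close>
  then have kernel: "h p = h q" if "p \<in> carrier ?F" "q \<in> carrier ?F"
      "wedge3_relations B #>\<^bsub>?F\<^esub> p = wedge3_relations B #>\<^bsub>?F\<^esub> q" for p q
  proof -
    assume K: "wedge3_relations B \<subseteq> kernel ?F A h"
    have "p \<in> wedge3_relations B #>\<^bsub>?F\<^esub> q"
      using that normal F.rcos_self[of p "wedge3_relations B"] normal_imp_subgroup by blast
    then obtain r where "r \<in> wedge3_relations B" "p = r \<otimes>\<^bsub>?F\<^esub> q"
      by (auto simp: r_coset_def)
    then show "h p = h q"
      using K that(2) h.hom_mult[of r q] by (auto simp: kernel_def)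
  qed
  obtain \<phi> where \<phi>: "\<phi> \<in> hom (?F Mod wedge3_relations B) A"
    "\<And>p. p \<in> carrier ?F \<Longrightarrow> \<phi> (wedge3_relations B #>\<^bsub>?F\<^esub> p) = h p"
    using FactGroup_universal[OF h normal kernel] by blast
  show thesis
  proof (rule that)
    show "\<phi> \<in> hom (exterior_cube B) A"
      using \<phi>(1) by (simp add: exterior_cube_def)
    show "\<phi> (wedge3 B x y z) = g x y z"
      if "x \<in> carrier B" "y \<in> carrier B" "z \<in> carrier B" for x y z
      using \<phi>(2)[OF frag_closed[OF that]] that by (simp add: wedge3_def)
  qed
qed

text \<open>The classes of triples generate the exterior cube. The proof pulls \<open>\<phi>\<close>
  back to the free abelian group, where triviality propagates from the generators by induction over
  differences.\<close>

lemma hom_exterior_cube_trivial_iff: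
  fixes A :: "'a monoid" and B :: "'b monoid"
  assumes "group A" and "monoid B" and \<phi>: "\<phi> \<in> hom (exterior_cube B) A"
  shows "(\<forall>\<omega> \<in> carrier (exterior_cube B). \<phi> \<omega> = \<one>\<^bsub>A\<^esub>) \<longleftrightarrow>
    (\<forall>x \<in> carrier B. \<forall>y \<in> carrier B. \<forall>z \<in> carrier B. \<phi> (wedge3 B x y z) = \<one>\<^bsub>A\<^esub>)"
proof
  assume trivial: "\<forall>x \<in> carrier B. \<forall>y \<in> carrier B. \<forall>z \<in> carrier B. \<phi> (wedge3 B x y z) = \<one>\<^bsub>A\<^esub>"
  let ?F = "free_Abelian_group (triples B)" and ?N = "wedge3_relations B"
  interpret A: group A by fact
  interpret F: comm_group ?F by (rule abelian_free_Abelian_group)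
  have "?N \<lhd> ?F"
    unfolding wedge3_relations_def using \<open>monoid B\<close>
    by (intro F.subgroup_imp_normal F.generate_is_subgroup wedge3_relators_closed)
  then interpret N: normal ?N ?F .
  interpret h: group_hom ?F A "\<lambda>p. \<phi> (?N #>\<^bsub>?F\<^esub> p)"
    using hom_compose[OF N.r_coset_hom_Mod \<phi>[unfolded exterior_cube_def]]
    by unfold_locales (simp add: comp_def)
  have "\<phi> (?N #>\<^bsub>?F\<^esub> p) = \<one>\<^bsub>A\<^esub>" if "Poly_Mapping.keys p \<subseteq> triples B" for p
  proof (rule free_Abelian_group_induct[OF that])
    show "\<phi> (?N #>\<^bsub>?F\<^esub> (p - q)) = \<one>\<^bsub>A\<^esub>"
      if "Poly_Mapping.keys p \<subseteq> triples B" "Poly_Mapping.keys q \<subseteq> triples B"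
        "\<phi> (?N #>\<^bsub>?F\<^esub> p) = \<one>\<^bsub>A\<^esub>" "\<phi> (?N #>\<^bsub>?F\<^esub> q) = \<one>\<^bsub>A\<^esub>" for p q
      using h.hom_mult[of p "inv\<^bsub>?F\<^esub> q"] h.hom_inv[of q] that by simp
    show "\<phi> (?N #>\<^bsub>?F\<^esub> frag_of t) = \<one>\<^bsub>A\<^esub>" if "t \<in> triples B" for t
      using trivial that by (auto simp: triples_def wedge3_def)
  qed (use h.hom_one in simp)
  then show "\<forall>\<omega> \<in> carrier (exterior_cube B). \<phi> \<omega> = \<one>\<^bsub>A\<^esub>"
    by (auto simp: exterior_cube_def FactGroup_def RCOSETS_def)
next
  assume "\<forall>\<omega> \<in> carrier (exterior_cube B). \<phi> \<omega> = \<one>\<^bsub>A\<^esub>"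
  moreover have "wedge3 B x y z \<in> carrier (exterior_cube B)"
    if "x \<in> carrier B" "y \<in> carrier B" "z \<in> carrier B" for x y z
    using that by (auto simp: wedge3_def exterior_cube_def FactGroup_def RCOSETS_def triples_def)
  ultimately show "\<forall>x \<in> carrier B. \<forall>y \<in> carrier B. \<forall>z \<in> carrier B. \<phi> (wedge3 B x y z) = \<one>\<^bsub>A\<^esub>"
    by blast
qed

section \<open>Coordinates of arrows\<close>

locale described_groupoid = grouplike_monoidal_groupoid C + A: comm_group A + B: comm_group B
  for A :: "'a monoid" and B :: "'b monoid" and C :: "('o, 'm) moncat" (structure) +
  fixes \<alpha> :: "'a \<Rightarrow> 'm" and X :: "'b \<Rightarrow> 'o" and c :: "'b \<Rightarrow> 'b \<Rightarrow> 'm" and f :: "'b \<Rightarrow> 'b \<Rightarrow> 'b \<Rightarrow> 'a"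
  assumes \<alpha>_iso: "\<alpha> \<in> iso A (Aut C (Unit C))"
    and trivial_action: "trivial_pi0_action C"
    and X_Obj [simp]: "x \<in> carrier B \<Longrightarrow> X x \<in> Obj C"
    and c_homs: "\<lbrakk>x \<in> carrier B; y \<in> carrier B\<rbrakk> \<Longrightarrow> c x y \<in> homs C (X x \<boxdot> X y) (X (x \<otimes>\<^bsub>B\<^esub> y))"
    and cocycle: "describing_cocycle C A B \<alpha> X c f"
begin

lemma c_simps [simp]:
  assumes "x \<in> carrier B" "y \<in> carrier B"
  shows "c x y \<in> Arr C" "Src C (c x y) = X x \<boxdot> X y" "Tgt C (c x y) = X (x \<otimes>\<^bsub>B\<^esub> y)"
  using c_homs[OF assms] by (auto simp: homs_def)

lemma f_closed [simp]:
  "\<lbrakk>x \<in> carrier B; y \<in> carrier B; z \<in> carrier B\<rbrakk> \<Longrightarrow> f x y z \<in> carrier A"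
  using cocycle by (auto simp: describing_cocycle_def)

section \<open>The automorphisms of an object as scalars in A\<close>

definition scalar :: "'o \<Rightarrow> 'a \<Rightarrow> 'm" where
  "scalar P g = aut_left C P (\<alpha> g)"

lemma \<alpha>_homs [simp]: "g \<in> carrier A \<Longrightarrow> \<alpha> g \<in> homs C (Unit C) (Unit C)"
  using \<alpha>_iso by (auto simp: iso_def bij_betw_def Aut_def Isom_eq_homs)

lemma scalar_simps [simp]:
  assumes "P \<in> Obj C" "g \<in> carrier A"
  shows "scalar P g \<in> Arr C" "Src C (scalar P g) = P" "Tgt C (scalar P g) = P"
  using assms by (simp_all add: scalar_def)

lemma scalar_one [simp]:
  assumes "P \<in> Obj C"
  shows "scalar P \<one>\<^bsub>A\<^esub> = Ident C P"
proof -
  interpret Aut: group "Aut C (Unit C)" by (simp add: group_Aut)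
  interpret \<alpha>: group_hom A "Aut C (Unit C)" \<alpha>
    using \<alpha>_iso by unfold_locales (simp add: iso_def)
  show ?thesis
    using \<alpha>.hom_one assms by (simp add: scalar_def aut_left_Ident Aut_def)
qed

lemma scalar_mult:
  assumes "P \<in> Obj C" "g \<in> carrier A" "h \<in> carrier A"
  shows "scalar P (g \<otimes>\<^bsub>A\<^esub> h) = scalar P g \<cdot> scalar P h"
  using \<alpha>_iso assms by (simp add: scalar_def iso_def hom_def Aut_def aut_left_Comp)

lemma scalar_natural:
  "\<lbrakk>u \<in> Arr C; g \<in> carrier A\<rbrakk> \<Longrightarrow> u \<cdot> scalar (Src C u) g = scalar (Tgt C u) g \<cdot> u"
  by (simp add: scalar_def aut_left_natural)

text \<open>This is where triviality of the action is used: a scalar on the right factor is an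
  \<open>aut_right\<close> on the left factor, which triviality turns back into an
  \<open>aut_left\<close>.\<close>

lemma scalar_TenA:
  assumes "P \<in> Obj C" "Q \<in> Obj C" "g \<in> carrier A" "h \<in> carrier A"
  shows "scalar P g \<boxtimes> scalar Q h = scalar (P \<boxdot> Q) (g \<otimes>\<^bsub>A\<^esub> h)"
proof -
  have "scalar P g \<boxtimes> scalar Q h = (scalar P g \<boxtimes> Ident C Q) \<cdot> (Ident C P \<boxtimes> scalar Q h)"
    using assms by (simp add: TenA_Comp_Arr)
  also have "Ident C P \<boxtimes> scalar Q h = scalar (P \<boxdot> Q) h"
    using assms trivial_pi0_actionD[OF trivial_action, of P "\<alpha> h"]
    by (simp add: scalar_def Ident_TenA_aut_left aut_left_TenA_Ident)
  also have "scalar P g \<boxtimes> Ident C Q = scalar (P \<boxdot> Q) g"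
    using assms by (simp add: scalar_def aut_left_TenA_Ident)
  finally show ?thesis
    using assms by (simp add: scalar_mult)
qed

lemma bij_betw_scalar:
  assumes "P \<in> Obj C"
  shows "bij_betw (scalar P) (carrier A) (homs C P P)"
proof -
  have "bij_betw \<alpha> (carrier A) (homs C (Unit C) (Unit C))"
    using \<alpha>_iso by (auto simp: iso_def Aut_def Isom_eq_homs)
  then have "bij_betw (aut_left C P \<circ> \<alpha>) (carrier A) (homs C P P)"
    using bij_betw_aut_left[OF assms] by (rule bij_betw_trans)
  then show ?thesis
    by (simp add: scalar_def[abs_def] comp_def)
qed

text \<open>The arrows \<open>m\<close> and \<open>n\<close> with the same target \<open>T\<close> identify the set of arrows between their
  sources with \<open>Aut T = A\<close>.\<close>

definition coord :: "'m \<Rightarrow> 'm \<Rightarrow> 'm \<Rightarrow> 'a \<Rightarrow> bool" where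
  "coord m n u g \<longleftrightarrow> m \<in> Arr C \<and> n \<in> Arr C \<and> Tgt C m = Tgt C n \<and>
     u \<in> homs C (Src C m) (Src C n) \<and> g \<in> carrier A \<and> n \<cdot> u = scalar (Tgt C n) g \<cdot> m"

text \<open>The coordinate is the scalar given by \<open>n\<close>, \<open>u\<close> and the inverse
  of \<open>m\<close> on the common target, so existence and uniqueness come from
  \<open>bij_betw_scalar\<close>.\<close>

lemma coord_ex1:
  assumes "m \<in> Arr C" "n \<in> Arr C" "Tgt C m = Tgt C n" "u \<in> homs C (Src C m) (Src C n)"
  shows "\<exists>!g. coord m n u g"
proof -
  have u: "u \<in> Arr C" "Src C u = Src C m" "Tgt C u = Src C n"
    using assms by (auto simp: homs_def)
  let ?k = "(n \<cdot> u) \<cdot> inv_arrow C m"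
  have bij: "bij_betw (scalar (Tgt C n)) (carrier A) (homs C (Tgt C n) (Tgt C n))"
    using assms by (simp add: bij_betw_scalar)
  moreover have "?k \<in> homs C (Tgt C n) (Tgt C n)"
    using assms u by (simp add: homs_def)
  ultimately obtain g where g: "g \<in> carrier A" "scalar (Tgt C n) g = ?k"
    unfolding bij_betw_def by (metis imageE)
  have "\<exists>!g. g \<in> carrier A \<and> scalar (Tgt C n) g = ?k"
  proof (rule ex1I[of _ g])
    fix h assume "h \<in> carrier A \<and> scalar (Tgt C n) h = ?k"
    then show "h = g"
      using inj_onD[OF bij_betw_imp_inj_on[OF bij], of h g] g by simp
  qed (use g in simp)
  moreover have "scalar (Tgt C n) g = ?k \<longleftrightarrow> n \<cdot> u = scalar (Tgt C n) g \<cdot> m"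
    if "g \<in> carrier A" for g
  proof
    assume "scalar (Tgt C n) g = ?k"
    then show "n \<cdot> u = scalar (Tgt C n) g \<cdot> m"
      using assms u by (simp add: Comp_assoc_Arr)
  next
    assume "n \<cdot> u = scalar (Tgt C n) g \<cdot> m"
    then show "scalar (Tgt C n) g = ?k"
      using assms u that by (simp add: Comp_assoc_Arr)
  qed
  ultimately show ?thesis
    using assms by (auto simp: coord_def)
qed

lemma coord_unique: "\<lbrakk>coord m n u g; coord m n u h\<rbrakk> \<Longrightarrow> g = h"
  using coord_ex1[of m n u] by (auto simp: coord_def)

lemma coord_inject:
  assumes "coord m n u g" "coord m n v g"
  shows "u = v"
proof (rule Comp_left_cancel)
  show "n \<cdot> u = n \<cdot> v"
    using assms by (simp add: coord_def)
qed (use assms in \<open>auto simp: coord_def homs_def\<close>)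

lemma coord_eq_iff: "\<lbrakk>coord m n u g; coord m n v h\<rbrakk> \<Longrightarrow> u = v \<longleftrightarrow> g = h"
  using coord_unique coord_inject by blast

lemma coord_Comp:
  assumes "coord m n u g" "coord n p v h"
  shows "coord m p (v \<cdot> u) (h \<otimes>\<^bsub>A\<^esub> g)"
proof -
  have *: "u \<in> Arr C" "Src C u = Src C m" "Tgt C u = Src C n" "v \<in> Arr C" "Src C v = Src C n"
    "Tgt C v = Src C p" "m \<in> Arr C" "n \<in> Arr C" "p \<in> Arr C" "Tgt C m = Tgt C p" "Tgt C n = Tgt C p"
    "g \<in> carrier A" "h \<in> carrier A" "n \<cdot> u = scalar (Tgt C p) g \<cdot> m" "p \<cdot> v = scalar (Tgt C p) h \<cdot> n"
    using assms by (auto simp: coord_def homs_def)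
  have "p \<cdot> (v \<cdot> u) = (p \<cdot> v) \<cdot> u"
    using *(1-13) by (simp add: Comp_assoc_Arr)
  also have "\<dots> = (scalar (Tgt C p) h \<cdot> n) \<cdot> u"
    by (simp only: *(15))
  also have "\<dots> = scalar (Tgt C p) h \<cdot> (n \<cdot> u)"
    using *(1-13) by (simp add: Comp_assoc_Arr)
  also have "\<dots> = scalar (Tgt C p) (h \<otimes>\<^bsub>A\<^esub> g) \<cdot> m"
    using * by (simp add: scalar_mult Comp_assoc_Arr)
  finally show ?thesis
    using * by (simp add: coord_def homs_def)
qed

lemma coord_Ident: "m \<in> Arr C \<Longrightarrow> coord m m (Ident C (Src C m)) \<one>\<^bsub>A\<^esub>"
  by (simp add: coord_def homs_def)

text \<open>Applied to \<open>c x y\<close>, this is why the arrows at the two ends of each partial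
  law contribute nothing to its coordinate.\<close>

lemma coord_self: "m \<in> Arr C \<Longrightarrow> coord m (Ident C (Tgt C m)) m \<one>\<^bsub>A\<^esub>"
  by (simp add: coord_def homs_def)

lemma coord_inv_arrow:
  assumes "coord m n u g"
  shows "coord n m (inv_arrow C u) (inv\<^bsub>A\<^esub> g)"
proof -
  have *: "u \<in> Arr C" "Src C u = Src C m" "Tgt C u = Src C n" "m \<in> Arr C" "n \<in> Arr C"
    "Tgt C m = Tgt C n" "g \<in> carrier A"
    using assms by (auto simp: coord_def homs_def)
  then have "inv_arrow C u \<in> homs C (Src C n) (Src C m)"
    by (simp add: homs_def)
  then obtain h where h: "coord n m (inv_arrow C u) h"
    using coord_ex1[of n m "inv_arrow C u"] * by auto
  have "coord m m (Ident C (Src C m)) (h \<otimes>\<^bsub>A\<^esub> g)"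
    using coord_Comp[OF assms h] * by simp
  then have "h \<otimes>\<^bsub>A\<^esub> g = \<one>\<^bsub>A\<^esub>"
    using coord_Ident * coord_unique by blast
  then have "h = inv\<^bsub>A\<^esub> g"
    using h * by (simp add: coord_def A.inv_equality)
  with h show ?thesis
    by simp
qed

lemma coord_scalar:
  assumes "coord m n u g" "a \<in> carrier A"
  shows "coord m n (scalar (Tgt C u) a \<cdot> u) (a \<otimes>\<^bsub>A\<^esub> g)"
proof (rule coord_Comp[OF assms(1)])
  show "coord n n (scalar (Tgt C u) a) a"
    using assms scalar_natural[of n a] by (auto simp: coord_def homs_def)
qed

text \<open>Joins arrows from two objects to \<open>X x\<close> and \<open>X y\<close>. Iterated, it
  maps a bracketed word of objects to a single chosen object along \<open>c\<close>, following the
  brackets.\<close>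

definition mark :: "'b \<Rightarrow> 'b \<Rightarrow> 'm \<Rightarrow> 'm \<Rightarrow> 'm" where
  "mark x y m n = c x y \<cdot> (m \<boxtimes> n)"

lemma mark_simps [simp]:
  assumes "x \<in> carrier B" "y \<in> carrier B" "m \<in> Arr C" "Tgt C m = X x" "n \<in> Arr C" "Tgt C n = X y"
  shows "mark x y m n \<in> Arr C" "Src C (mark x y m n) = Src C m \<boxdot> Src C n"
    "Tgt C (mark x y m n) = X (x \<otimes>\<^bsub>B\<^esub> y)"
  using assms by (simp_all add: mark_def)

lemma mark_Ident [simp]:
  "\<lbrakk>x \<in> carrier B; y \<in> carrier B\<rbrakk> \<Longrightarrow> mark x y (Ident C (X x)) (Ident C (X y)) = c x y"
  by (simp add: mark_def TenA_Ident)

text \<open>By \<open>scalar_TenA\<close> the two scalars become one scalar of the product, which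
  passes \<open>c x y\<close> by naturality.\<close>

lemma coord_TenA:
  assumes u: "coord m n u g" and v: "coord p q v h"
    and xy: "x \<in> carrier B" "y \<in> carrier B" "Tgt C m = X x" "Tgt C p = X y"
  shows "coord (mark x y m p) (mark x y n q) (u \<boxtimes> v) (g \<otimes>\<^bsub>A\<^esub> h)"
proof -
  have *: "u \<in> Arr C" "Src C u = Src C m" "Tgt C u = Src C n" "m \<in> Arr C" "n \<in> Arr C"
    "Tgt C n = X x" "g \<in> carrier A" "n \<cdot> u = scalar (X x) g \<cdot> m"
    "v \<in> Arr C" "Src C v = Src C p" "Tgt C v = Src C q" "p \<in> Arr C" "q \<in> Arr C"
    "Tgt C q = X y" "h \<in> carrier A" "q \<cdot> v = scalar (X y) h \<cdot> p"
    using assms by (auto simp: coord_def homs_def)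
  have "mark x y n q \<cdot> (u \<boxtimes> v) = c x y \<cdot> ((n \<cdot> u) \<boxtimes> (q \<cdot> v))"
    using xy * by (simp add: mark_def Comp_assoc_Arr TenA_Comp_Arr)
  also have "\<dots> = c x y \<cdot> ((scalar (X x) g \<boxtimes> scalar (X y) h) \<cdot> (m \<boxtimes> p))"
    using xy * by (simp add: TenA_Comp_Arr)
  also have "\<dots> = (c x y \<cdot> scalar (X x \<boxdot> X y) (g \<otimes>\<^bsub>A\<^esub> h)) \<cdot> (m \<boxtimes> p)"
    using xy * by (simp add: scalar_TenA Comp_assoc_Arr)
  also have "\<dots> = scalar (X (x \<otimes>\<^bsub>B\<^esub> y)) (g \<otimes>\<^bsub>A\<^esub> h) \<cdot> mark x y m p"
    using xy * scalar_natural[of "c x y" "g \<otimes>\<^bsub>A\<^esub> h"] by (simp add: mark_def Comp_assoc_Arr)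
  finally show ?thesis
    using xy * by (simp add: coord_def homs_def)
qed

text \<open>Naturality of \<open>Assoc\<close> moves the marks out and leaves the isomorphism
  between chosen objects, where the equation defining \<open>f\<close> applies. The marks are
  arbitrary because the pentagon has associativity isomorphisms at product objects.\<close>

lemma coord_Assoc:
  assumes xyz: "x \<in> carrier B" "y \<in> carrier B" "z \<in> carrier B"
    and m: "m \<in> Arr C" "Tgt C m = X x" and n: "n \<in> Arr C" "Tgt C n = X y"
    and p: "p \<in> Arr C" "Tgt C p = X z"
  shows "coord (mark x (y \<otimes>\<^bsub>B\<^esub> z) m (mark y z n p)) (mark (x \<otimes>\<^bsub>B\<^esub> y) z (mark x y m n) p)
    (Assoc C (Src C m) (Src C n) (Src C p)) (f x y z)"
proof -
  let ?a = "Assoc C (Src C m) (Src C n) (Src C p)"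
  have "mark (x \<otimes>\<^bsub>B\<^esub> y) z (mark x y m n) p \<cdot> ?a =
      c (x \<otimes>\<^bsub>B\<^esub> y) z \<cdot> ((c x y \<boxtimes> Ident C (X z)) \<cdot> (((m \<boxtimes> n) \<boxtimes> p) \<cdot> ?a))"
  proof -
    have "(c x y \<cdot> (m \<boxtimes> n)) \<boxtimes> p = (c x y \<boxtimes> Ident C (X z)) \<cdot> ((m \<boxtimes> n) \<boxtimes> p)"
      using assms by (simp add: TenA_Comp_Arr)
    then show ?thesis
      using assms by (simp add: mark_def Comp_assoc_Arr)
  qed
  also have "\<dots> = (c (x \<otimes>\<^bsub>B\<^esub> y) z \<cdot> (c x y \<boxtimes> Ident C (X z)) \<cdot> Assoc C (X x) (X y) (X z)) \<cdot>
      (m \<boxtimes> (n \<boxtimes> p))"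
    using assms Assoc_natural_Arr[of m n p] by (simp add: Comp_assoc_Arr)
  also have "c (x \<otimes>\<^bsub>B\<^esub> y) z \<cdot> (c x y \<boxtimes> Ident C (X z)) \<cdot> Assoc C (X x) (X y) (X z) =
      scalar (X (x \<otimes>\<^bsub>B\<^esub> y \<otimes>\<^bsub>B\<^esub> z)) (f x y z) \<cdot> c x (y \<otimes>\<^bsub>B\<^esub> z) \<cdot> (Ident C (X x) \<boxtimes> c y z)"
    using cocycle xyz by (simp add: describing_cocycle_def scalar_def)
  also have "\<dots> \<cdot> (m \<boxtimes> (n \<boxtimes> p)) =
      scalar (X (x \<otimes>\<^bsub>B\<^esub> y \<otimes>\<^bsub>B\<^esub> z)) (f x y z) \<cdot> mark x (y \<otimes>\<^bsub>B\<^esub> z) m (mark y z n p)"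
    using assms by (simp add: mark_def Comp_assoc_Arr TenA_Comp_Arr B.m_assoc)
  finally show ?thesis
    using assms by (simp add: coord_def homs_def B.m_assoc)
qed

text \<open>The cocycle identity compares the coordinates of both sides of the pentagon.\<close>

lemma f_cocycle:
  assumes "w \<in> carrier B" "x \<in> carrier B" "y \<in> carrier B" "z \<in> carrier B"
  shows "f (w \<otimes>\<^bsub>B\<^esub> x) y z \<otimes>\<^bsub>A\<^esub> f w x (y \<otimes>\<^bsub>B\<^esub> z) =
    f w x y \<otimes>\<^bsub>A\<^esub> f w (x \<otimes>\<^bsub>B\<^esub> y) z \<otimes>\<^bsub>A\<^esub> f x y z"
proof -
  let ?e = "\<lambda>x. Ident C (X x)" and ?wx = "w \<otimes>\<^bsub>B\<^esub> x" and ?xy = "x \<otimes>\<^bsub>B\<^esub> y" and ?yz = "y \<otimes>\<^bsub>B\<^esub> z"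
  \<comment> \<open>The five marks stand at the vertices of the pentagon, each an iterate of
    \<open>c\<close> along one bracketing of the four objects.\<close>
  let ?m1 = "mark w (x \<otimes>\<^bsub>B\<^esub> ?yz) (?e w) (mark x ?yz (?e x) (c y z))"
  let ?m2 = "mark ?wx ?yz (c w x) (c y z)"
  let ?m3 = "mark (?wx \<otimes>\<^bsub>B\<^esub> y) z (mark ?wx y (c w x) (?e y)) (?e z)"
  let ?m4 = "mark w (?xy \<otimes>\<^bsub>B\<^esub> z) (?e w) (mark ?xy z (c x y) (?e z))"
  let ?m5 = "mark (w \<otimes>\<^bsub>B\<^esub> ?xy) z (mark w ?xy (?e w) (c x y)) (?e z)"
  have e: "coord (?e v) (?e v) (?e v) \<one>\<^bsub>A\<^esub>" if "v \<in> carrier B" for v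
    using coord_Ident[of "?e v"] that by simp
  have "coord ?m1 ?m2 (Assoc C (X w) (X x) (X y \<boxdot> X z)) (f w x ?yz)"
    using coord_Assoc[of w x ?yz "?e w" "?e x" "c y z"] assms by simp
  moreover have "coord ?m2 ?m3 (Assoc C (X w \<boxdot> X x) (X y) (X z)) (f ?wx y z)"
    using coord_Assoc[of ?wx y z "c w x" "?e y" "?e z"] assms by simp
  ultimately have 1: "coord ?m1 ?m3
      (Assoc C (X w \<boxdot> X x) (X y) (X z) \<cdot> Assoc C (X w) (X x) (X y \<boxdot> X z)) (f ?wx y z \<otimes>\<^bsub>A\<^esub> f w x ?yz)"
    by (rule coord_Comp)
  have "coord ?m1 ?m4 (?e w \<boxtimes> Assoc C (X x) (X y) (X z)) (f x y z)"
    using coord_TenA[OF e[of w] coord_Assoc[of x y z "?e x" "?e y" "?e z"], of w "x \<otimes>\<^bsub>B\<^esub> ?yz"] assms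
    by (simp add: B.m_assoc)
  moreover have "coord ?m4 ?m5 (Assoc C (X w) (X x \<boxdot> X y) (X z)) (f w ?xy z)"
    using coord_Assoc[of w ?xy z "?e w" "c x y" "?e z"] assms by simp
  moreover have "coord ?m5 ?m3 (Assoc C (X w) (X x) (X y) \<boxtimes> ?e z) (f w x y)"
    using coord_TenA[OF coord_Assoc[of w x y "?e w" "?e x" "?e y"] e[of z], of "w \<otimes>\<^bsub>B\<^esub> ?xy" z] assms
    by (simp add: B.m_assoc)
  ultimately have "coord ?m1 ?m3 ((Assoc C (X w) (X x) (X y) \<boxtimes> ?e z) \<cdot>
      Assoc C (X w) (X x \<boxdot> X y) (X z) \<cdot> (?e w \<boxtimes> Assoc C (X x) (X y) (X z)))
      (f w x y \<otimes>\<^bsub>A\<^esub> (f w ?xy z \<otimes>\<^bsub>A\<^esub> f x y z))"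
    by (meson coord_Comp)
  with 1 show ?thesis
    using assms coord_unique by (simp add: pentagon A.m_assoc)
qed

end

sublocale described_groupoid \<subseteq> abelian_3_cocycle A B f
  by unfold_locales (use f_cocycle in auto)

section \<open>The partial laws in coordinates\<close>

context described_groupoid
begin

text \<open>Both arrows end at \<open>X\<^bsub>xy\<^esub> = X\<^bsub>yx\<^esub>\<close>, as \<open>B\<close> is commutative.\<close>

definition fibre_coord :: "'b \<Rightarrow> 'b \<Rightarrow> 'm \<Rightarrow> 'a \<Rightarrow> bool" where
  "fibre_coord x y = coord (c y x) (c x y)"

lemma fibre_coord_ex1:
  assumes "x \<in> carrier B" "y \<in> carrier B" "u \<in> commutator_fibre C X x y"
  shows "\<exists>!g. fibre_coord x y u g"
  using assms unfolding fibre_coord_def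
  by (intro coord_ex1) (simp_all add: commutator_fibre_def Isom_eq_homs B.m_comm)

lemma fibre_coordE:
  assumes "x \<in> carrier B" "y \<in> carrier B" "u \<in> commutator_fibre C X x y"
  obtains g where "g \<in> carrier A" "fibre_coord x y u g"
  using fibre_coord_ex1[OF assms] by (auto simp: fibre_coord_def coord_def)

lemma fibre_coord_fibre:
  "\<lbrakk>x \<in> carrier B; y \<in> carrier B; fibre_coord x y u g\<rbrakk> \<Longrightarrow> u \<in> commutator_fibre C X x y"
  by (simp add: fibre_coord_def coord_def commutator_fibre_def Isom_eq_homs)

lemma fibre_coord_eq_iff:
  "\<lbrakk>fibre_coord x y u g; fibre_coord x y v h\<rbrakk> \<Longrightarrow> u = v \<longleftrightarrow> g = h"
  unfolding fibre_coord_def by (rule coord_eq_iff)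

lemma fibre_coord_action:
  assumes "x \<in> carrier B" "y \<in> carrier B" "fibre_coord x y u g" "a \<in> carrier A"
  shows "fibre_coord x y (commutator_action C \<alpha> X x y a u) (a \<otimes>\<^bsub>A\<^esub> g)"
  using coord_scalar[of "c y x" "c x y" u g a] assms
  by (simp add: fibre_coord_def commutator_action_def scalar_def coord_def[of _ _ u] homs_def)

text \<open>The vertices of the composite get marks with a common target, so each of the seven
  arrows has a coordinate and these multiply: \<open>u\<close> and \<open>v\<close> give
  \<open>g\<close> and \<open>h\<close>, the ends give one, and the three associativity isomorphisms
  give the factors of \<open>kappa\<close>.\<close>

lemma fibre_coord_law1:
  assumes xy: "x \<in> carrier B" "x' \<in> carrier B" "y \<in> carrier B"
    and u: "fibre_coord x y u g" and v: "fibre_coord x' y v h"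
  shows "fibre_coord (x \<otimes>\<^bsub>B\<^esub> x') y (commutator_law1 C X c x x' y u v) (g \<otimes>\<^bsub>A\<^esub> h \<otimes>\<^bsub>A\<^esub> kappa x x' y)"
proof -
  let ?e = "\<lambda>x. Ident C (X x)"
  have e: "coord (?e z) (?e z) (?e z) \<one>\<^bsub>A\<^esub>" if "z \<in> carrier B" for z
    using coord_Ident[of "?e z"] that by simp
  have gh: "g \<in> carrier A" "h \<in> carrier A"
    using u v by (auto simp: fibre_coord_def coord_def)
  \<comment> \<open>Commutativity of B gives \<open>c y x\<close> and \<open>c x y\<close> the same
    target, so that one index serves for the marks on both sides of \<open>u\<close>, and likewise
    of \<open>v\<close>.\<close>
  have comm: "y \<otimes>\<^bsub>B\<^esub> x = x \<otimes>\<^bsub>B\<^esub> y" "y \<otimes>\<^bsub>B\<^esub> x' = x' \<otimes>\<^bsub>B\<^esub> y"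
    using xy by (simp_all add: B.m_comm)
  have c: "coord (c x x') (?e (x \<otimes>\<^bsub>B\<^esub> x')) (c x x') \<one>\<^bsub>A\<^esub>"
    using coord_self[of "c x x'"] xy by simp
  have 1: "coord (c y (x \<otimes>\<^bsub>B\<^esub> x')) (mark y (x \<otimes>\<^bsub>B\<^esub> x') (?e y) (c x x'))
      (?e y \<boxtimes> inv_arrow C (c x x')) \<one>\<^bsub>A\<^esub>"
    using coord_TenA[OF e[of y] coord_inv_arrow[OF c], of y "x \<otimes>\<^bsub>B\<^esub> x'"] xy by simp
  have 2: "coord (mark y (x \<otimes>\<^bsub>B\<^esub> x') (?e y) (c x x')) (mark (x \<otimes>\<^bsub>B\<^esub> y) x' (c y x) (?e x'))
      (Assoc C (X y) (X x) (X x')) (f y x x')"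
    using coord_Assoc[of y x x' "?e y" "?e x" "?e x'"] xy by (simp add: comm)
  have 3: "coord (mark (x \<otimes>\<^bsub>B\<^esub> y) x' (c y x) (?e x')) (mark (x \<otimes>\<^bsub>B\<^esub> y) x' (c x y) (?e x'))
      (u \<boxtimes> ?e x') g"
    using coord_TenA[OF u[unfolded fibre_coord_def] e[of x'], of "x \<otimes>\<^bsub>B\<^esub> y" x'] xy gh by (simp add: comm)
  have 4: "coord (mark (x \<otimes>\<^bsub>B\<^esub> y) x' (c x y) (?e x')) (mark x (x' \<otimes>\<^bsub>B\<^esub> y) (?e x) (c y x'))
      (inv_arrow C (Assoc C (X x) (X y) (X x'))) (inv\<^bsub>A\<^esub> f x y x')"
    using coord_inv_arrow[OF coord_Assoc[of x y x' "?e x" "?e y" "?e x'"]] xy by (simp add: comm)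
  have 5: "coord (mark x (x' \<otimes>\<^bsub>B\<^esub> y) (?e x) (c y x')) (mark x (x' \<otimes>\<^bsub>B\<^esub> y) (?e x) (c x' y))
      (?e x \<boxtimes> v) h"
    using coord_TenA[OF e[of x] v[unfolded fibre_coord_def], of x "x' \<otimes>\<^bsub>B\<^esub> y"] xy gh by (simp add: comm)
  have 6: "coord (mark x (x' \<otimes>\<^bsub>B\<^esub> y) (?e x) (c x' y)) (mark (x \<otimes>\<^bsub>B\<^esub> x') y (c x x') (?e y))
      (Assoc C (X x) (X x') (X y)) (f x x' y)"
    using coord_Assoc[of x x' y "?e x" "?e x'" "?e y"] xy by simp
  have 7: "coord (mark (x \<otimes>\<^bsub>B\<^esub> x') y (c x x') (?e y)) (c (x \<otimes>\<^bsub>B\<^esub> x') y) (c x x' \<boxtimes> ?e y) \<one>\<^bsub>A\<^esub>"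
    using coord_TenA[OF c e[of y], of "x \<otimes>\<^bsub>B\<^esub> x'" y] xy by simp
  note coord_Comp[OF coord_Comp[OF coord_Comp[OF coord_Comp[OF coord_Comp[OF coord_Comp[OF 1 2] 3] 4] 5] 6] 7]
  then show ?thesis
    using xy gh by (simp add: fibre_coord_def commutator_law1_def kappa_def A.m_ac)
qed

text \<open>Two associativity isomorphisms are inverted here and one is not, the reverse of the
  first law; hence the inverse of \<open>kappa\<close>.\<close>

lemma fibre_coord_law2:
  assumes xy: "x \<in> carrier B" "y \<in> carrier B" "y' \<in> carrier B"
    and u: "fibre_coord x y u g" and w: "fibre_coord x y' w h"
  shows "fibre_coord x (y \<otimes>\<^bsub>B\<^esub> y') (commutator_law2 C X c x y y' u w)
    (g \<otimes>\<^bsub>A\<^esub> h \<otimes>\<^bsub>A\<^esub> inv\<^bsub>A\<^esub> kappa y y' x)"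
proof -
  let ?e = "\<lambda>x. Ident C (X x)"
  have e: "coord (?e z) (?e z) (?e z) \<one>\<^bsub>A\<^esub>" if "z \<in> carrier B" for z
    using coord_Ident[of "?e z"] that by simp
  have gh: "g \<in> carrier A" "h \<in> carrier A"
    using u w by (auto simp: fibre_coord_def coord_def)
  have comm: "y \<otimes>\<^bsub>B\<^esub> x = x \<otimes>\<^bsub>B\<^esub> y" "y' \<otimes>\<^bsub>B\<^esub> x = x \<otimes>\<^bsub>B\<^esub> y'"
    using xy by (simp_all add: B.m_comm)
  have c: "coord (c y y') (?e (y \<otimes>\<^bsub>B\<^esub> y')) (c y y') \<one>\<^bsub>A\<^esub>"
    using coord_self[of "c y y'"] xy by simp
  have 1: "coord (c (y \<otimes>\<^bsub>B\<^esub> y') x) (mark (y \<otimes>\<^bsub>B\<^esub> y') x (c y y') (?e x))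
      (inv_arrow C (c y y') \<boxtimes> ?e x) \<one>\<^bsub>A\<^esub>"
    using coord_TenA[OF coord_inv_arrow[OF c] e[of x], of "y \<otimes>\<^bsub>B\<^esub> y'" x] xy by simp
  have 2: "coord (mark (y \<otimes>\<^bsub>B\<^esub> y') x (c y y') (?e x)) (mark y (x \<otimes>\<^bsub>B\<^esub> y') (?e y) (c y' x))
      (inv_arrow C (Assoc C (X y) (X y') (X x))) (inv\<^bsub>A\<^esub> f y y' x)"
    using coord_inv_arrow[OF coord_Assoc[of y y' x "?e y" "?e y'" "?e x"]] xy by (simp add: comm)
  have 3: "coord (mark y (x \<otimes>\<^bsub>B\<^esub> y') (?e y) (c y' x)) (mark y (x \<otimes>\<^bsub>B\<^esub> y') (?e y) (c x y'))
      (?e y \<boxtimes> w) h"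
    using coord_TenA[OF e[of y] w[unfolded fibre_coord_def], of y "x \<otimes>\<^bsub>B\<^esub> y'"] xy gh by (simp add: comm)
  have 4: "coord (mark y (x \<otimes>\<^bsub>B\<^esub> y') (?e y) (c x y')) (mark (x \<otimes>\<^bsub>B\<^esub> y) y' (c y x) (?e y'))
      (Assoc C (X y) (X x) (X y')) (f y x y')"
    using coord_Assoc[of y x y' "?e y" "?e x" "?e y'"] xy by (simp add: comm)
  have 5: "coord (mark (x \<otimes>\<^bsub>B\<^esub> y) y' (c y x) (?e y')) (mark (x \<otimes>\<^bsub>B\<^esub> y) y' (c x y) (?e y'))
      (u \<boxtimes> ?e y') g"
    using coord_TenA[OF u[unfolded fibre_coord_def] e[of y'], of "x \<otimes>\<^bsub>B\<^esub> y" y'] xy gh by (simp add: comm)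
  have 6: "coord (mark (x \<otimes>\<^bsub>B\<^esub> y) y' (c x y) (?e y')) (mark x (y \<otimes>\<^bsub>B\<^esub> y') (?e x) (c y y'))
      (inv_arrow C (Assoc C (X x) (X y) (X y'))) (inv\<^bsub>A\<^esub> f x y y')"
    using coord_inv_arrow[OF coord_Assoc[of x y y' "?e x" "?e y" "?e y'"]] xy by simp
  have 7: "coord (mark x (y \<otimes>\<^bsub>B\<^esub> y') (?e x) (c y y')) (c x (y \<otimes>\<^bsub>B\<^esub> y')) (?e x \<boxtimes> c y y') \<one>\<^bsub>A\<^esub>"
    using coord_TenA[OF e[of x] c, of x "y \<otimes>\<^bsub>B\<^esub> y'"] xy by simp
  note coord_Comp[OF coord_Comp[OF coord_Comp[OF coord_Comp[OF coord_Comp[OF coord_Comp[OF 1 2] 3] 4] 5] 6] 7]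
  then show ?thesis
    using xy gh by (simp add: fibre_coord_def commutator_law2_def kappa_def A.inv_mult A.m_ac)
qed

section \<open>The commutator biextension\<close>

abbreviation "E \<equiv> commutator_fibre C X"
abbreviation "act \<equiv> commutator_action C \<alpha> X"
abbreviation "law1 \<equiv> commutator_law1 C X c"
abbreviation "law2 \<equiv> commutator_law2 C X c"

lemma commutator_fibre_nonempty:
  assumes "x \<in> carrier B" "y \<in> carrier B"
  shows "E x y \<noteq> {}"
proof -
  have "inv_arrow C (c x y) \<cdot> c y x \<in> E x y"
    using assms by (simp add: commutator_fibre_def Isom_eq_homs homs_def B.m_comm)
  then show ?thesis by blast
qed

section \<open>The axioms of a weak biextension\<close>

lemma commutator_torsor: "torsor_on_square A B E act"
  unfolding torsor_on_square_def
proof (intro ballI conjI)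
  fix x y assume xy: "x \<in> carrier B" "y \<in> carrier B"
  then show "E x y \<noteq> {}"
    by (rule commutator_fibre_nonempty)
  fix u assume "u \<in> E x y"
  then obtain g where g: "g \<in> carrier A" "fibre_coord x y u g"
    using fibre_coordE xy by blast
  show "act x y \<one>\<^bsub>A\<^esub> u = u"
    using fibre_coord_eq_iff[OF fibre_coord_action[OF xy g(2)] g(2), of "\<one>\<^bsub>A\<^esub>"] g by simp
  show "act x y a u \<in> E x y" if "a \<in> carrier A" for a
    using fibre_coord_fibre fibre_coord_action xy g that by blast
  show "act x y (a \<otimes>\<^bsub>A\<^esub> b) u = act x y a (act x y b u)" if "a \<in> carrier A" "b \<in> carrier A" for a b
    using fibre_coord_eq_iff[OF fibre_coord_action[OF xy g(2), of "a \<otimes>\<^bsub>A\<^esub> b"]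
        fibre_coord_action[OF xy fibre_coord_action[OF xy g(2), of b], of a]] that g
    by (simp add: A.m_assoc)
  fix v assume "v \<in> E x y"
  then obtain h where h: "h \<in> carrier A" "fibre_coord x y v h"
    using fibre_coordE xy by blast
  have "act x y a u = v \<longleftrightarrow> a = h \<otimes>\<^bsub>A\<^esub> inv\<^bsub>A\<^esub> g" if "a \<in> carrier A" for a
    using fibre_coord_eq_iff[OF fibre_coord_action[OF xy g(2) that] h(2)] that g h
    by (metis A.inv_closed A.inv_solve_right' A.m_closed)
  then show "\<exists>!a. a \<in> carrier A \<and> act x y a u = v"
    using g h by (intro ex1I[of _ "h \<otimes>\<^bsub>A\<^esub> inv\<^bsub>A\<^esub> g"]) auto
qed

lemma law1_closed:
  assumes "x \<in> carrier B" "x' \<in> carrier B" "y \<in> carrier B" "u \<in> E x y" "v \<in> E x' y"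
  shows "law1 x x' y u v \<in> E (x \<otimes>\<^bsub>B\<^esub> x') y"
  using assms by (meson B.m_closed fibre_coordE fibre_coord_fibre fibre_coord_law1)

lemma law2_closed:
  assumes "x \<in> carrier B" "y \<in> carrier B" "y' \<in> carrier B" "u \<in> E x y" "w \<in> E x y'"
  shows "law2 x y y' u w \<in> E x (y \<otimes>\<^bsub>B\<^esub> y')"
  using assms by (meson B.m_closed fibre_coordE fibre_coord_fibre fibre_coord_law2)

lemma law1_act:
  assumes xy: "x \<in> carrier B" "x' \<in> carrier B" "y \<in> carrier B" and uv: "u \<in> E x y" "v \<in> E x' y"
    and ab: "a \<in> carrier A" "b \<in> carrier A"
  shows "law1 x x' y (act x y a u) (act x' y b v) = act (x \<otimes>\<^bsub>B\<^esub> x') y (a \<otimes>\<^bsub>A\<^esub> b) (law1 x x' y u v)"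
proof -
  obtain g where g: "g \<in> carrier A" "fibre_coord x y u g"
    by (rule fibre_coordE[OF xy(1,3) uv(1)])
  obtain h where h: "h \<in> carrier A" "fibre_coord x' y v h"
    by (rule fibre_coordE[OF xy(2,3) uv(2)])
  note fibre_coord_law1[OF xy fibre_coord_action[OF xy(1,3) g(2) ab(1)] fibre_coord_action[OF xy(2,3) h(2) ab(2)]]
  moreover note fibre_coord_action[OF B.m_closed[OF xy(1,2)] xy(3) fibre_coord_law1[OF xy g(2) h(2)] A.m_closed[OF ab]]
  ultimately show ?thesis
    using xy g h ab by (simp add: fibre_coord_eq_iff A.m_ac)
qed

lemma law2_act:
  assumes xy: "x \<in> carrier B" "y \<in> carrier B" "y' \<in> carrier B" and uw: "u \<in> E x y" "w \<in> E x y'"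
    and ab: "a \<in> carrier A" "b \<in> carrier A"
  shows "law2 x y y' (act x y a u) (act x y' b w) = act x (y \<otimes>\<^bsub>B\<^esub> y') (a \<otimes>\<^bsub>A\<^esub> b) (law2 x y y' u w)"
proof -
  obtain g where g: "g \<in> carrier A" "fibre_coord x y u g"
    by (rule fibre_coordE[OF xy(1,2) uw(1)])
  obtain h where h: "h \<in> carrier A" "fibre_coord x y' w h"
    by (rule fibre_coordE[OF xy(1,3) uw(2)])
  note fibre_coord_law2[OF xy fibre_coord_action[OF xy(1,2) g(2) ab(1)] fibre_coord_action[OF xy(1,3) h(2) ab(2)]]
  moreover note fibre_coord_action[OF xy(1) B.m_closed[OF xy(2,3)] fibre_coord_law2[OF xy g(2) h(2)] A.m_closed[OF ab]]
  ultimately show ?thesis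
    using xy g h ab by (simp add: fibre_coord_eq_iff A.m_ac)
qed

lemma law1_assoc:
  assumes xy: "x \<in> carrier B" "x' \<in> carrier B" "x'' \<in> carrier B" "y \<in> carrier B"
    and uvw: "u \<in> E x y" "v \<in> E x' y" "w \<in> E x'' y"
  shows "law1 (x \<otimes>\<^bsub>B\<^esub> x') x'' y (law1 x x' y u v) w = law1 x (x' \<otimes>\<^bsub>B\<^esub> x'') y u (law1 x' x'' y v w)"
proof -
  obtain g where g: "g \<in> carrier A" "fibre_coord x y u g"
    by (rule fibre_coordE[OF xy(1,4) uvw(1)])
  obtain h where h: "h \<in> carrier A" "fibre_coord x' y v h"
    by (rule fibre_coordE[OF xy(2,4) uvw(2)])
  obtain k where k: "k \<in> carrier A" "fibre_coord x'' y w k"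
    by (rule fibre_coordE[OF xy(3,4) uvw(3)])
  let ?l = "g \<otimes>\<^bsub>A\<^esub> h \<otimes>\<^bsub>A\<^esub> kappa x x' y \<otimes>\<^bsub>A\<^esub> k \<otimes>\<^bsub>A\<^esub> kappa (x \<otimes>\<^bsub>B\<^esub> x') x'' y"
  let ?r = "g \<otimes>\<^bsub>A\<^esub> (h \<otimes>\<^bsub>A\<^esub> k \<otimes>\<^bsub>A\<^esub> kappa x' x'' y) \<otimes>\<^bsub>A\<^esub> kappa x (x' \<otimes>\<^bsub>B\<^esub> x'') y"
  have "fibre_coord (x \<otimes>\<^bsub>B\<^esub> x' \<otimes>\<^bsub>B\<^esub> x'') y (law1 (x \<otimes>\<^bsub>B\<^esub> x') x'' y (law1 x x' y u v) w) ?l"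
    using xy g h k by (intro fibre_coord_law1) simp_all
  moreover have "fibre_coord (x \<otimes>\<^bsub>B\<^esub> (x' \<otimes>\<^bsub>B\<^esub> x'')) y (law1 x (x' \<otimes>\<^bsub>B\<^esub> x'') y u (law1 x' x'' y v w)) ?r"
    using xy g h k by (intro fibre_coord_law1) simp_all
  \<comment> \<open>The two values of \<open>kappa\<close> are brought together so that
    \<open>kappa_cocycle\<close> can rewrite their product.\<close>
  moreover have "?l = g \<otimes>\<^bsub>A\<^esub> h \<otimes>\<^bsub>A\<^esub> k \<otimes>\<^bsub>A\<^esub> (kappa x x' y \<otimes>\<^bsub>A\<^esub> kappa (x \<otimes>\<^bsub>B\<^esub> x') x'' y)"
    using xy g h k by (simp add: A.m_ac)
  then have "?l = ?r"
    using xy g h k by (simp add: kappa_cocycle) (simp add: A.m_ac)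
  ultimately show ?thesis
    using xy by (simp add: fibre_coord_eq_iff B.m_assoc)
qed

lemma law2_assoc:
  assumes xy: "x \<in> carrier B" "y \<in> carrier B" "y' \<in> carrier B" "y'' \<in> carrier B"
    and uvw: "u \<in> E x y" "v \<in> E x y'" "w \<in> E x y''"
  shows "law2 x (y \<otimes>\<^bsub>B\<^esub> y') y'' (law2 x y y' u v) w = law2 x y (y' \<otimes>\<^bsub>B\<^esub> y'') u (law2 x y' y'' v w)"
proof -
  obtain g where g: "g \<in> carrier A" "fibre_coord x y u g"
    by (rule fibre_coordE[OF xy(1,2) uvw(1)])
  obtain h where h: "h \<in> carrier A" "fibre_coord x y' v h"
    by (rule fibre_coordE[OF xy(1,3) uvw(2)])
  obtain k where k: "k \<in> carrier A" "fibre_coord x y'' w k"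
    by (rule fibre_coordE[OF xy(1,4) uvw(3)])
  let ?l = "g \<otimes>\<^bsub>A\<^esub> h \<otimes>\<^bsub>A\<^esub> inv\<^bsub>A\<^esub> kappa y y' x \<otimes>\<^bsub>A\<^esub> k \<otimes>\<^bsub>A\<^esub> inv\<^bsub>A\<^esub> kappa (y \<otimes>\<^bsub>B\<^esub> y') y'' x"
  let ?r = "g \<otimes>\<^bsub>A\<^esub> (h \<otimes>\<^bsub>A\<^esub> k \<otimes>\<^bsub>A\<^esub> inv\<^bsub>A\<^esub> kappa y' y'' x) \<otimes>\<^bsub>A\<^esub> inv\<^bsub>A\<^esub> kappa y (y' \<otimes>\<^bsub>B\<^esub> y'') x"
  have "fibre_coord x (y \<otimes>\<^bsub>B\<^esub> y' \<otimes>\<^bsub>B\<^esub> y'') (law2 x (y \<otimes>\<^bsub>B\<^esub> y') y'' (law2 x y y' u v) w) ?l"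
    using xy g h k by (intro fibre_coord_law2) simp_all
  moreover have "fibre_coord x (y \<otimes>\<^bsub>B\<^esub> (y' \<otimes>\<^bsub>B\<^esub> y'')) (law2 x y (y' \<otimes>\<^bsub>B\<^esub> y'') u (law2 x y' y'' v w)) ?r"
    using xy g h k by (intro fibre_coord_law2) simp_all
  moreover have "?l = g \<otimes>\<^bsub>A\<^esub> h \<otimes>\<^bsub>A\<^esub> k \<otimes>\<^bsub>A\<^esub> inv\<^bsub>A\<^esub> (kappa y y' x \<otimes>\<^bsub>A\<^esub> kappa (y \<otimes>\<^bsub>B\<^esub> y') y'' x)"
    using xy g h k by (simp add: A.inv_mult A.m_ac)
  then have "?l = ?r"
    using xy g h k by (simp add: kappa_cocycle) (simp add: A.inv_mult A.m_ac)
  ultimately show ?thesis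
    using xy by (simp add: fibre_coord_eq_iff B.m_assoc)
qed

lemma law_interchange:
  assumes xy: "x \<in> carrier B" "x' \<in> carrier B" "y \<in> carrier B" "y' \<in> carrier B"
    and rstu: "r \<in> E x y" "s \<in> E x' y" "t \<in> E x y'" "u \<in> E x' y'"
  shows "law2 (x \<otimes>\<^bsub>B\<^esub> x') y y' (law1 x x' y r s) (law1 x x' y' t u) =
    law1 x x' (y \<otimes>\<^bsub>B\<^esub> y') (law2 x y y' r t) (law2 x' y y' s u)"
proof -
  obtain g where g: "g \<in> carrier A" "fibre_coord x y r g"
    by (rule fibre_coordE[OF xy(1,3) rstu(1)])
  obtain h where h: "h \<in> carrier A" "fibre_coord x' y s h"
    by (rule fibre_coordE[OF xy(2,3) rstu(2)])
  obtain k where k: "k \<in> carrier A" "fibre_coord x y' t k"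
    by (rule fibre_coordE[OF xy(1,4) rstu(3)])
  obtain l where l: "l \<in> carrier A" "fibre_coord x' y' u l"
    by (rule fibre_coordE[OF xy(2,4) rstu(4)])
  let ?p = "kappa x x' y \<otimes>\<^bsub>A\<^esub> kappa x x' y'" and ?q = "kappa y y' x \<otimes>\<^bsub>A\<^esub> kappa y y' x'"
  let ?p' = "kappa x x' (y \<otimes>\<^bsub>B\<^esub> y')" and ?q' = "kappa y y' (x \<otimes>\<^bsub>B\<^esub> x')"
  \<comment> \<open>\<open>kappa_interchange\<close> with \<open>?q\<close> and \<open>?q'\<close>
    moved to the opposite sides, because the second law contributes inverses.\<close>
  have kappa: "?p \<otimes>\<^bsub>A\<^esub> inv\<^bsub>A\<^esub> ?q' = ?p' \<otimes>\<^bsub>A\<^esub> inv\<^bsub>A\<^esub> ?q"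
  proof -
    have "?p = (?p' \<otimes>\<^bsub>A\<^esub> ?q') \<otimes>\<^bsub>A\<^esub> inv\<^bsub>A\<^esub> ?q"
      using kappa_interchange[OF xy] xy by (subst A.inv_solve_right) simp_all
    also have "\<dots> = (?p' \<otimes>\<^bsub>A\<^esub> inv\<^bsub>A\<^esub> ?q) \<otimes>\<^bsub>A\<^esub> ?q'"
      using xy by (simp add: A.inv_mult A.m_ac)
    finally show ?thesis
      using xy by (subst A.inv_solve_right') simp_all
  qed
  let ?l = "(g \<otimes>\<^bsub>A\<^esub> h \<otimes>\<^bsub>A\<^esub> kappa x x' y) \<otimes>\<^bsub>A\<^esub> (k \<otimes>\<^bsub>A\<^esub> l \<otimes>\<^bsub>A\<^esub> kappa x x' y') \<otimes>\<^bsub>A\<^esub> inv\<^bsub>A\<^esub> ?q'"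
  let ?r = "(g \<otimes>\<^bsub>A\<^esub> k \<otimes>\<^bsub>A\<^esub> inv\<^bsub>A\<^esub> kappa y y' x) \<otimes>\<^bsub>A\<^esub> (h \<otimes>\<^bsub>A\<^esub> l \<otimes>\<^bsub>A\<^esub> inv\<^bsub>A\<^esub> kappa y y' x') \<otimes>\<^bsub>A\<^esub> ?p'"
  have "fibre_coord (x \<otimes>\<^bsub>B\<^esub> x') (y \<otimes>\<^bsub>B\<^esub> y')
      (law2 (x \<otimes>\<^bsub>B\<^esub> x') y y' (law1 x x' y r s) (law1 x x' y' t u)) ?l"
    using xy g h k l by (intro fibre_coord_law2 fibre_coord_law1) simp_all
  moreover have "fibre_coord (x \<otimes>\<^bsub>B\<^esub> x') (y \<otimes>\<^bsub>B\<^esub> y')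
      (law1 x x' (y \<otimes>\<^bsub>B\<^esub> y') (law2 x y y' r t) (law2 x' y y' s u)) ?r"
    using xy g h k l by (intro fibre_coord_law2 fibre_coord_law1) simp_all
  moreover have "?l = g \<otimes>\<^bsub>A\<^esub> h \<otimes>\<^bsub>A\<^esub> k \<otimes>\<^bsub>A\<^esub> l \<otimes>\<^bsub>A\<^esub> (?p \<otimes>\<^bsub>A\<^esub> inv\<^bsub>A\<^esub> ?q')"
    using xy g h k l by (simp add: A.m_ac)
  then have "?l = ?r"
    unfolding kappa using xy g h k l by (simp add: A.inv_mult A.m_ac)
  ultimately show ?thesis
    by (simp add: fibre_coord_eq_iff)
qed

lemma commutator_weak_biextension: "weak_biextension A B E act law1 law2"
  unfolding weak_biextension_def
  by (intro conjI ballI)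
    (assumption | rule commutator_torsor law1_closed law2_closed law1_act law2_act
      law1_assoc law2_assoc law_interchange)+

text \<open>The coordinates of \<open>u\<close> and \<open>v\<close> enter symmetrically and cancel.
  The answer is therefore independent of \<open>u\<close> and \<open>v\<close>, and a single pair
  decides.\<close>

lemma law1_commute_iff:
  assumes xy: "x \<in> carrier B" "x' \<in> carrier B" "y \<in> carrier B" and uv: "u \<in> E x y" "v \<in> E x' y"
  shows "law1 x x' y u v = law1 x' x y v u \<longleftrightarrow> alt x x' y = \<one>\<^bsub>A\<^esub>"
proof -
  obtain g where g: "g \<in> carrier A" "fibre_coord x y u g"
    by (rule fibre_coordE[OF xy(1,3) uv(1)])
  obtain h where h: "h \<in> carrier A" "fibre_coord x' y v h"
    by (rule fibre_coordE[OF xy(2,3) uv(2)])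
  have "law1 x x' y u v = law1 x' x y v u \<longleftrightarrow>
      g \<otimes>\<^bsub>A\<^esub> h \<otimes>\<^bsub>A\<^esub> kappa x x' y = h \<otimes>\<^bsub>A\<^esub> g \<otimes>\<^bsub>A\<^esub> kappa x' x y"
    using fibre_coord_law1[OF xy g(2) h(2)] fibre_coord_law1[OF xy(2,1,3) h(2) g(2)] xy
    by (simp add: fibre_coord_eq_iff B.m_comm)
  also have "\<dots> \<longleftrightarrow> kappa x x' y = kappa x' x y"
    using xy g h by (simp add: A.m_comm[of h g])
  also have "\<dots> \<longleftrightarrow> alt x x' y = \<one>\<^bsub>A\<^esub>"
    using xy A.inv_solve_right'[of "\<one>\<^bsub>A\<^esub>" "kappa x x' y" "kappa x' x y"] by (auto simp: alt_eq_kappa)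
  finally show ?thesis .
qed

text \<open>Inverting \<open>kappa\<close> does not change when it is symmetric, so the obstruction
  is again \<open>alt\<close>, now with the two added indices first and \<open>x\<close>
  last.\<close>

lemma law2_commute_iff:
  assumes xy: "x \<in> carrier B" "y \<in> carrier B" "y' \<in> carrier B" and uw: "u \<in> E x y" "w \<in> E x y'"
  shows "law2 x y y' u w = law2 x y' y w u \<longleftrightarrow> alt y y' x = \<one>\<^bsub>A\<^esub>"
proof -
  obtain g where g: "g \<in> carrier A" "fibre_coord x y u g"
    by (rule fibre_coordE[OF xy(1,2) uw(1)])
  obtain h where h: "h \<in> carrier A" "fibre_coord x y' w h"
    by (rule fibre_coordE[OF xy(1,3) uw(2)])
  have "law2 x y y' u w = law2 x y' y w u \<longleftrightarrow>
      g \<otimes>\<^bsub>A\<^esub> h \<otimes>\<^bsub>A\<^esub> inv\<^bsub>A\<^esub> kappa y y' x = h \<otimes>\<^bsub>A\<^esub> g \<otimes>\<^bsub>A\<^esub> inv\<^bsub>A\<^esub> kappa y' y x"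
    using fibre_coord_law2[OF xy g(2) h(2)] fibre_coord_law2[OF xy(1,3,2) h(2) g(2)] xy
    by (simp add: fibre_coord_eq_iff B.m_comm)
  also have "\<dots> \<longleftrightarrow> kappa y y' x = kappa y' y x"
    using xy g h by (simp add: A.m_comm[of h g]) (metis A.inv_inv kappa_closed)
  also have "\<dots> \<longleftrightarrow> alt y y' x = \<one>\<^bsub>A\<^esub>"
    using xy A.inv_solve_right'[of "\<one>\<^bsub>A\<^esub>" "kappa y y' x" "kappa y' y x"] by (auto simp: alt_eq_kappa)
  finally show ?thesis .
qed

text \<open>Commutativity of the first law alone makes \<open>alt\<close> trivial, as its three
  indices are arbitrary and the fibres are nonempty; conversely \<open>alt\<close> controls both
  laws.\<close>

lemma biextension_iff_alt_trivial:
  "biextension A B E act law1 law2 \<longleftrightarrow>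
    (\<forall>x \<in> carrier B. \<forall>y \<in> carrier B. \<forall>z \<in> carrier B. alt x y z = \<one>\<^bsub>A\<^esub>)"
proof
  assume biext: "biextension A B E act law1 law2"
  show "\<forall>x \<in> carrier B. \<forall>y \<in> carrier B. \<forall>z \<in> carrier B. alt x y z = \<one>\<^bsub>A\<^esub>"
  proof (intro ballI)
    fix x y z assume xyz: "x \<in> carrier B" "y \<in> carrier B" "z \<in> carrier B"
    then obtain u v where "u \<in> E x z" "v \<in> E y z"
      using commutator_fibre_nonempty by (meson ex_in_conv)
    then show "alt x y z = \<one>\<^bsub>A\<^esub>"
    proof -
      assume uv: "u \<in> E x z" "v \<in> E y z"
      have "law1 x y z u v = law1 y x z v u"
        using biext[unfolded biextension_def, THEN conjunct2, THEN conjunct1] xyz uv by blast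
      then show ?thesis
        by (simp only: law1_commute_iff[OF xyz uv])
    qed
  qed
next
  assume "\<forall>x \<in> carrier B. \<forall>y \<in> carrier B. \<forall>z \<in> carrier B. alt x y z = \<one>\<^bsub>A\<^esub>"
  then show "biextension A B E act law1 law2"
    unfolding biextension_def
    by (intro conjI ballI commutator_weak_biextension) (simp_all add: law1_commute_iff law2_commute_iff)
qed

end

theorem proposition4p1:
  fixes A :: "'a monoid" and B :: "'b monoid" and C :: "('o, 'm) moncat"
    and \<alpha> :: "'a \<Rightarrow> 'm" and \<beta> :: "'b \<Rightarrow> 'o set"
    and X :: "'b \<Rightarrow> 'o" and c :: "'b \<Rightarrow> 'b \<Rightarrow> 'm"
    and f :: "'b \<Rightarrow> 'b \<Rightarrow> 'b \<Rightarrow> 'a"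
  assumes "comm_group A" and "comm_group B"
    and "grouplike_monoidal_groupoid C"
    and "\<beta> \<in> iso B (pi0 C)" and "\<alpha> \<in> iso A (Aut C (Unit C))"
    and "trivial_pi0_action C"
    and "chosen_representatives C B \<beta> X c"
    and "describing_cocycle C A B \<alpha> X c f"
  shows "\<exists>\<phi> \<in> hom (exterior_cube B) A.
           (\<forall>x \<in> carrier B. \<forall>y \<in> carrier B. \<forall>z \<in> carrier B.
              \<phi> (wedge3 B x y z) =
                (f x y z \<otimes>\<^bsub>A\<^esub> f z x y \<otimes>\<^bsub>A\<^esub> f y z x) \<otimes>\<^bsub>A\<^esub>
                inv\<^bsub>A\<^esub> (f x z y \<otimes>\<^bsub>A\<^esub> f z y x \<otimes>\<^bsub>A\<^esub> f y x z)) \<and>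
           (biextension A B (commutator_fibre C X) (commutator_action C \<alpha> X)
              (commutator_law1 C X c) (commutator_law2 C X c) \<longleftrightarrow>
            (\<forall>\<omega> \<in> carrier (exterior_cube B). \<phi> \<omega> = \<one>\<^bsub>A\<^esub>))"
proof -
  interpret A: comm_group A by fact
  interpret B: comm_group B by fact
  interpret C: grouplike_monoidal_groupoid C by fact
  \<comment> \<open>Elements of \<open>pi0 C\<close> are sets of objects, so a representative of the
    class \<open>\<beta> x\<close> is an object.\<close>
  have X_Obj: "X x \<in> Obj C" if "x \<in> carrier B" for x
  proof -
    have "\<beta> x \<in> iso_class C ` Obj C"
      using assms(4) that hom_in_carrier[of \<beta> B "pi0 C" x] by (simp add: iso_def pi0_def)
    moreover have "X x \<in> \<beta> x"
      using assms(7) that by (simp add: chosen_representatives_def)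
    ultimately show ?thesis
      by (auto simp: iso_class_def)
  qed
  interpret described_groupoid A B C \<alpha> X c f
  proof unfold_locales
    show "c x y \<in> homs C (X x \<boxdot>\<^bsub>C\<^esub> X y) (X (x \<otimes>\<^bsub>B\<^esub> y))" if "x \<in> carrier B" "y \<in> carrier B" for x y
      using assms(7) that by (simp add: chosen_representatives_def)
  qed (fact assms X_Obj)+
  obtain \<phi> where \<phi>: "\<phi> \<in> hom (exterior_cube B) A"
    "\<And>x y z. \<lbrakk>x \<in> carrier B; y \<in> carrier B; z \<in> carrier B\<rbrakk> \<Longrightarrow> \<phi> (wedge3 B x y z) = alt x y z"
    by (rule exterior_cube_universal[OF assms(1,2), of alt])
      (assumption | rule that alt_closed alt_mult1 alt_mult2 alt_mult3 alt_repeat | simp)+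
  show ?thesis
  proof (intro bexI[of _ \<phi>] conjI ballI \<phi>(2)[unfolded alt_def])
    show "biextension A B E act law1 law2 \<longleftrightarrow> (\<forall>\<omega> \<in> carrier (exterior_cube B). \<phi> \<omega> = \<one>\<^bsub>A\<^esub>)"
      unfolding hom_exterior_cube_trivial_iff[OF A.group_axioms B.monoid_axioms \<phi>(1)]
        biextension_iff_alt_trivial
      by (simp add: \<phi>(2))
  qed (assumption | fact \<phi>(1))+
qed

end
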